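(* Let $G$ be a Gromov hyperbolic group and let $L$ be an algebraic length function on $G$ (the word-length with respect to some finite generating set). Then for every normalized 2-cocycle $\sigma$ on $G$, $\{r^L\}_{r\to1^-}$ is a bounded Fourier summing net for $(G,\sigma)$.
   Context: $\sigma:G\times G\to\mathbb{T}$ is a normalized 2-cocycle ($\sigma(g,h)\sigma(gh,k)=\sigma(h,k)\sigma(g,hk)$, $\sigma(g,e)=\sigma(e,g)=1$); $\Lambda_\sigma(g)$ is the unitary on $\ell^2(G)$ with $(\Lambda_\sigma(g)\xi)(h)=\sigma(g,g^{-1}h)\xi(g^{-1}h)$; $C^*_r(G,\sigma)$ is the operator-norm closure of $\mathrm{span}\,\Lambda_\sigma(G)$; for $x\in C^*_r(G,\sigma)$, $\widehat x=x\delta_e$. For $\varphi:G\to\mathbb{C}$, $M_\varphi$ is the linear map with $M_\varphi(\Lambda_\sigma(g))=\varphi(g)\Lambda_\sigma(g)$ (extended to $C^*_r(G,\sigma)$ when bounded). $MCF(G,\sigma)$ = set of $\varphi$ such that $\sum_g\varphi(g)\widehat x(g)\Lambda_\sigma(g)$ converges in operator norm (as a net of finite partial sums) for all $x\in C^*_r(G,\sigma)$. A Fourier summing net for $(G,\sigma)$ is a net $\{\varphi_\alpha\}\subseteq MCF(G,\sigma)$ with $M_{\varphi_\alpha}(x)\to x$ in operator norm for all $x$; bounded means $\sup_\alpha\|M_{\varphi_\alpha}\|<\infty$. *)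

theory Defs
  imports "HOL-Analysis.Analysis"
begin

text \<open>Groups are modelled as types of class group_add (not necessarily commutative):
  the group product g h is written g + h, the inverse is -g, the identity is 0.\<close>

definition generating_set :: "'g::group_add set \<Rightarrow> bool" where
  "generating_set S \<longleftrightarrow>
     (\<forall>g. \<exists>ws. set ws \<subseteq> S \<union> uminus ` S \<and> sum_list ws = g)"

definition word_length :: "'g::group_add set \<Rightarrow> 'g \<Rightarrow> nat" where
  "word_length S g =
     (LEAST n. \<exists>ws. length ws = n \<and> set ws \<subseteq> S \<union> uminus ` S \<and> sum_list ws = g)"

definition word_metric :: "'g::group_add set \<Rightarrow> 'g \<Rightarrow> 'g \<Rightarrow> real" where
  "word_metric S g h = real (word_length S (- g + h))"

definition gromov_product :: "'g::group_add set \<Rightarrow> 'g \<Rightarrow> 'g \<Rightarrow> 'g \<Rightarrow> real" where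
  "gromov_product S x y w =
     (word_metric S w x + word_metric S w y - word_metric S x y) / 2"

definition gromov_hyperbolic_group :: "'g::group_add itself \<Rightarrow> bool" where
  "gromov_hyperbolic_group TYPE('g) \<longleftrightarrow>
     (\<exists>S::'g set. finite S \<and> generating_set S \<and>
        (\<exists>\<delta>\<ge>0. \<forall>x y z w. gromov_product S x y w \<ge>
             min (gromov_product S x z w) (gromov_product S y z w) - \<delta>))"

definition normalized_2cocycle :: "('g::group_add \<Rightarrow> 'g \<Rightarrow> complex) \<Rightarrow> bool" where
  "normalized_2cocycle \<sigma> \<longleftrightarrow>
     (\<forall>g h. cmod (\<sigma> g h) = 1) \<and>
     (\<forall>g h k. \<sigma> g h * \<sigma> (g + h) k = \<sigma> h k * \<sigma> g (h + k)) \<and>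
     (\<forall>g. \<sigma> g 0 = 1 \<and> \<sigma> 0 g = 1)"

definition l2 :: "('g \<Rightarrow> complex) set" where
  "l2 = {\<xi>. (\<lambda>g. (cmod (\<xi> g))\<^sup>2) summable_on UNIV}"

definition l2norm :: "('g \<Rightarrow> complex) \<Rightarrow> real" where
  "l2norm \<xi> = sqrt (infsum (\<lambda>g. (cmod (\<xi> g))\<^sup>2) UNIV)"

text \<open>Operators on l2(G) are represented as functions on all of 'g => complex;
  only their behaviour on l2 matters. opbound T c means: T maps l2 into l2 and
  its operator norm is at most c.\<close>

definition opbound :: "(('g \<Rightarrow> complex) \<Rightarrow> ('g \<Rightarrow> complex)) \<Rightarrow> real \<Rightarrow> bool" where
  "opbound T c \<longleftrightarrow> (\<forall>\<xi>\<in>l2. T \<xi> \<in> l2 \<and> l2norm (T \<xi>) \<le> c * l2norm \<xi>)"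

definition Lambda :: "('g::group_add \<Rightarrow> 'g \<Rightarrow> complex) \<Rightarrow> 'g \<Rightarrow> ('g \<Rightarrow> complex) \<Rightarrow> ('g \<Rightarrow> complex)" where
  "Lambda \<sigma> g \<xi> = (\<lambda>h. \<sigma> g (- g + h) * \<xi> (- g + h))"

definition reduced_cstar :: "('g::group_add \<Rightarrow> 'g \<Rightarrow> complex) \<Rightarrow> (('g \<Rightarrow> complex) \<Rightarrow> ('g \<Rightarrow> complex)) set" where
  "reduced_cstar \<sigma> = {x. \<forall>\<epsilon>>0. \<exists>F c. finite F \<and>
      opbound (\<lambda>\<xi> h. x \<xi> h - (\<Sum>g\<in>F. c g * Lambda \<sigma> g \<xi> h)) \<epsilon>}"

definition delta_e :: "'g::group_add \<Rightarrow> complex" where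
  "delta_e = (\<lambda>h. if h = 0 then 1 else 0)"

definition fourier_coeff :: "(('g::group_add \<Rightarrow> complex) \<Rightarrow> ('g \<Rightarrow> complex)) \<Rightarrow> 'g \<Rightarrow> complex" where
  "fourier_coeff x = x delta_e"

definition fourier_sum_conv ::
  "('g::group_add \<Rightarrow> 'g \<Rightarrow> complex) \<Rightarrow> ('g \<Rightarrow> complex) \<Rightarrow>
   (('g \<Rightarrow> complex) \<Rightarrow> ('g \<Rightarrow> complex)) \<Rightarrow> (('g \<Rightarrow> complex) \<Rightarrow> ('g \<Rightarrow> complex)) \<Rightarrow> bool" where
  "fourier_sum_conv \<sigma> \<phi> x y \<longleftrightarrow>
     (\<forall>\<epsilon>>0. \<exists>F0. finite F0 \<and> (\<forall>F. finite F \<and> F0 \<subseteq> F \<longrightarrow>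
        opbound (\<lambda>\<xi> h. y \<xi> h - (\<Sum>g\<in>F. \<phi> g * fourier_coeff x g * Lambda \<sigma> g \<xi> h)) \<epsilon>))"

definition MCF :: "('g::group_add \<Rightarrow> 'g \<Rightarrow> complex) \<Rightarrow> ('g \<Rightarrow> complex) set" where
  "MCF \<sigma> = {\<phi>. \<forall>x\<in>reduced_cstar \<sigma>. \<exists>y. fourier_sum_conv \<sigma> \<phi> x y}"

text \<open>For phi in MCF, M_phi(x) is the (operator-norm) sum of the Fourier series
  sum_g phi(g) xhat(g) Lambda(g); it is determined on l2 by fourier_sum_conv.
  A net is given by an index set I directed by the filter F.\<close>

definition bounded_fourier_summing_net ::
  "('g::group_add \<Rightarrow> 'g \<Rightarrow> complex) \<Rightarrow> 'i filter \<Rightarrow> 'i set \<Rightarrow> ('i \<Rightarrow> 'g \<Rightarrow> complex) \<Rightarrow> bool" where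
  "bounded_fourier_summing_net \<sigma> F I \<phi> \<longleftrightarrow>
     (\<forall>\<alpha>\<in>I. \<phi> \<alpha> \<in> MCF \<sigma>) \<and>
     (\<forall>x\<in>reduced_cstar \<sigma>. \<forall>\<epsilon>>0. eventually (\<lambda>\<alpha>. \<alpha> \<in> I \<and>
          (\<forall>y. fourier_sum_conv \<sigma> (\<phi> \<alpha>) x y \<longrightarrow>
               opbound (\<lambda>\<xi> h. y \<xi> h - x \<xi> h) \<epsilon>)) F) \<and>
     (\<exists>C. \<forall>\<alpha>\<in>I. \<forall>x\<in>reduced_cstar \<sigma>. \<forall>y c.
          fourier_sum_conv \<sigma> (\<phi> \<alpha>) x y \<longrightarrow> opbound x c \<longrightarrow> opbound y (C * c))"

end

theory Submission
  imports Defs "HOL-Real_Asymp.Real_Asymp"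
begin

text \<open>
  The matrix of an element of the twisted group algebra in the canonical basis has entry
  f (h - k) * \<sigma> (h - k) k in row h and column k, so multiplying Fourier coefficients by
  a function of the word length is Schur multiplication by a function of the word distance between
  -h and -k, and the cocycle plays no role because it has modulus one.

  Two properties of the word metric suffice: a point z and two points x, y have an approximate
  tripod centre on a geodesic from x to y, and the points at approximate position j on approximate
  geodesics from x to z are uniformly boundedly many. The first hyperbolicity constant belongs to
  another generating set, so both are deduced from the Morse lemma. They give, following Ozawa, a
  factorization of the kernel r to the power d(x, y) through vectors of uniformly bounded norm,
  hence the uniform bound on the multipliers, and also Haagerup's inequality (rapid decay),
  hence norm convergence of the Fourier series for r < 1. Convergence as r tends to 1 is clear on
  finite sums and extends to the closure by the uniform bound.
\<close>

section \<open>Stability of quasi-geodesics\<close>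

text \<open>The kernel comes from r^d = (1 - r) * (sum of r^n over n \<ge> d). For each n the
  indicator of d x y \<le> n is a sum over k \<le> n of terms pairing data of (x, k) with data of
  (y, n - k), so that r^n = r^k * r^(n - k) is shared between two vectors. Two obstacles shape the
  construction. Several k may witness d x y \<le> n, and just one of them must be counted. Moreover,
  a sum over k of bounded vectors with weights r^k can have squared norm of order 1 / (1 - r)^2,
  while the factor 1 - r pays only for 1 / (1 - r); the smaller order holds because vectors for
  distant k have disjoint supports. A bound independent of r is essential for passing to the closure
  as r tends to 1: rapid decay alone bounds the multipliers only by a multiple of 1 / (1 -
  r)^2.\<close>

locale geodesic_nat_metric =
  fixes d :: "'a \<Rightarrow> 'a \<Rightarrow> nat"
  assumes d_refl [simp]: "d x x = 0"
    and d_zero: "d x y = 0 \<Longrightarrow> x = y"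
    and d_sym: "d x y = d y x"
    and d_tri: "d x z \<le> d x y + d y z"
    and d_geo: "k \<le> d x y \<Longrightarrow> \<exists>z. d x z = k \<and> d z y = d x y - k"
begin

definition gp :: "'a \<Rightarrow> 'a \<Rightarrow> 'a \<Rightarrow> real" where
  "gp x y w = (real (d w x) + real (d w y) - real (d x y)) / 2"

lemma gp_sym: "gp x y w = gp y x w"
  by (simp add: gp_def d_sym)

lemma path_dist:
  assumes "\<And>i. i < n \<Longrightarrow> d (c i) (c (Suc i)) \<le> l" "i \<le> j" "j \<le> n"
  shows "d (c i) (c j) \<le> l * (j - i)"
  using assms(2,3)
proof (induction j rule: dec_induct)
  case (step m)
  have "d (c i) (c (Suc m)) \<le> d (c i) (c m) + d (c m) (c (Suc m))" by (rule d_tri)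
  also have "\<dots> \<le> l * (m - i) + l" using step assms(1)[of m] by (intro add_mono) auto
  also have "\<dots> = l * (Suc m - i)" using step by (simp add: Suc_diff_le)
  finally show ?case .
qed simp

text \<open>Only the length and unit steps are prescribed, which is easy to check when a path is
  extended; that such a path is isometric is recovered in \<open>geodesic_dist\<close>.\<close>

definition geodesic :: "'a \<Rightarrow> 'a \<Rightarrow> (nat \<Rightarrow> 'a) \<Rightarrow> bool" where
  "geodesic x y c \<longleftrightarrow> c 0 = x \<and> c (d x y) = y \<and> (\<forall>i<d x y. d (c i) (c (Suc i)) \<le> 1)"

lemma geodesic_exists: "\<exists>c. geodesic x y c"
proof (induction "d x y" arbitrary: y)
  case 0
  then show ?case using d_zero[of x y] by (auto simp: geodesic_def)
next
  case (Suc n)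
  obtain z where z: "d x z = n" "d z y = 1"
    using d_geo[of n x y] Suc(2) by auto
  obtain c where c: "geodesic x z c" using Suc(1)[of z] z by auto
  have "geodesic x y (c(Suc n := y))"
    using c z Suc(2)[symmetric] by (auto simp: geodesic_def less_Suc_eq)
  then show ?case by blast
qed

text \<open>The three pieces of the path have lengths at most i, j - i and d x y - j, which add up
  to d x y; by the triangle inequality none of them can be shorter.\<close>

lemma geodesic_dist:
  assumes "geodesic x y c" "i \<le> j" "j \<le> d x y"
  shows "d (c i) (c j) = j - i"
proof -
  have st: "\<And>i. i < d x y \<Longrightarrow> d (c i) (c (Suc i)) \<le> 1" and e: "c 0 = x" "c (d x y) = y"
    using assms by (auto simp: geodesic_def)
  have "d (c i) (c j) \<le> j - i" using path_dist[of "d x y" c 1, OF st assms(2,3)] by simp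
  moreover have "d x (c i) \<le> i" using path_dist[of "d x y" c 1 0 i, OF st] assms e by simp
  moreover have "d (c j) y \<le> d x y - j"
    using path_dist[of "d x y" c 1 j "d x y", OF st] assms e by simp
  moreover have "d x y \<le> d x (c i) + d (c i) (c j) + d (c j) y"
    using d_tri[of x y "c i"] d_tri[of "c i" y "c j"] by linarith
  ultimately show ?thesis using assms by linarith
qed

lemma geodesic_ends:
  assumes "geodesic x y c" "i \<le> d x y"
  shows "d x (c i) = i" "d (c i) y = d x y - i"
  using geodesic_dist[OF assms(1), of 0 i] geodesic_dist[OF assms(1), of i "d x y"] assms
  by (auto simp: geodesic_def)

text \<open>A discrete quasi-geodesic. The upper bound is asked of single steps only, since
  \<open>path_dist\<close> adds them up; the lower bound is solved for j - i to stay within the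
  natural numbers.\<close>

definition quasi_path :: "nat \<Rightarrow> nat \<Rightarrow> (nat \<Rightarrow> 'a) \<Rightarrow> nat \<Rightarrow> bool" where
  "quasi_path l R c n \<longleftrightarrow> (\<forall>i<n. d (c i) (c (Suc i)) \<le> l) \<and>
     (\<forall>i j. i \<le> j \<and> j \<le> n \<longrightarrow> j - i \<le> l * d (c i) (c j) + R)"

end

text \<open>The numerical clash behind \<open>geodesic_near_quasi_path\<close>: an excursion of at
  most \<open>6 * l * D + R\<close> steps is bisected k times, with k logarithmic in D, and the
  total loss \<open>real l / 2 + (real k + 2) * \<delta>\<close> stays below D once D is
  large.\<close>

lemma log_dominated:
  fixes l R :: nat and \<delta> :: real
  assumes "\<delta> > 0"
  shows "\<exists>D0. \<forall>D::nat>D0. \<exists>k::nat. 6 * l * D + R \<le> 2 ^ k \<and> real l / 2 + (real k + 2) * \<delta> < real D"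
proof -
  define a where "a = 6 * real l + real R + 1"
  have a: "a > 0" by (simp add: a_def)
  have "eventually (\<lambda>D::nat. real l / 2 + (log 2 a + log 2 (real D) + 3) * \<delta> < real D) sequentially"
    using assms by real_asymp
  then obtain D1 where D1: "\<And>D::nat. D \<ge> D1 \<Longrightarrow> real l / 2 + (log 2 a + log 2 (real D) + 3) * \<delta> < real D"
    by (auto simp: eventually_sequentially)
  show ?thesis
  proof (rule exI[of _ "D1"], intro allI impI)
    fix D :: nat assume D: "D1 < D"
    hence Dp: "real D \<ge> 1" by simp
    define k where "k = nat \<lceil>log 2 (a * real D)\<rceil>"
    have a1: "a \<ge> 1" by (simp add: a_def)
    have "a * real D \<ge> 1" using mult_mono[OF a1 Dp] a1 by simp
    hence pos: "log 2 (a * real D) \<ge> 0" by simp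
    hence k1: "log 2 (a * real D) \<le> real k" and k2: "real k \<le> log 2 (a * real D) + 1"
      unfolding k_def by linarith+
    have "real (6 * l * D + R) \<le> a * real D"
    proof -
      have "real R * 1 \<le> real R * real D" using Dp by (intro mult_left_mono) auto
      thus ?thesis using Dp by (simp add: a_def algebra_simps)
    qed
    also have "\<dots> = 2 powr (log 2 (a * real D))" using a Dp by simp
    also have "\<dots> \<le> 2 powr real k" using k1 by simp
    also have "\<dots> = real (2 ^ k)" by (simp add: powr_realpow)
    finally have c1: "6 * l * D + R \<le> 2 ^ k" using of_nat_le_iff by blast
    have "log 2 (a * real D) = log 2 a + log 2 (real D)" using a Dp by (simp add: log_mult)
    hence "(real k + 2) * \<delta> \<le> (log 2 a + log 2 (real D) + 3) * \<delta>"
      using k2 assms by (intro mult_right_mono) auto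
    with D1[of D] D c1 show "\<exists>k::nat. 6 * l * D + R \<le> 2 ^ k \<and> real l / 2 + (real k + 2) * \<delta> < real D"
      by (intro exI[of _ k]) auto
  qed
qed

locale hyperbolic_nat_metric = geodesic_nat_metric +
  fixes \<delta> :: real
  assumes delta_pos: "\<delta> > 0"
    and hyp: "gp x y w \<ge> min (gp x z w) (gp y z w) - \<delta>"
begin

text \<open>Bisecting the chain costs one \<delta> per level, so 2^k steps cost only k of them. The
  separate hypothesis on \<open>gp (c a) (c a) w\<close> covers the chain without steps.\<close>

lemma gp_chain:
  assumes "\<And>i. a \<le> i \<Longrightarrow> i < b \<Longrightarrow> t \<le> gp (c i) (c (Suc i)) w"
    and "t \<le> gp (c a) (c a) w" and "a \<le> b" and "b - a \<le> 2 ^ k"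
  shows "t - real k * \<delta> \<le> gp (c a) (c b) w"
  using assms
proof (induction k arbitrary: a b)
  case 0
  then consider "b = a" | "b = Suc a" by fastforce
  then show ?case using 0 by cases auto
next
  case (Suc k)
  show ?case
  proof (cases "b = a")
    case True
    moreover have "real (Suc k) * \<delta> \<ge> 0" using delta_pos by simp
    ultimately show ?thesis using Suc.prems(2) by simp
  next
    case False
    define m where "m = (a + b) div 2"
    have m: "a \<le> m" "m < b" "m - a \<le> 2 ^ k" "b - m \<le> 2 ^ k"
      using Suc.prems False by (auto simp: m_def)
    have "t \<le> gp (c m) (c m) w"
    proof (cases "m = a")
      case False
      have "t \<le> gp (c m) (c (Suc m)) w" using Suc.prems m by auto
      also have "\<dots> \<le> real (d w (c m))"
        unfolding gp_def using d_tri[of w "c (Suc m)" "c m"] by (simp add: field_simps)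
      also have "\<dots> = gp (c m) (c m) w" by (simp add: gp_def)
      finally show ?thesis .
    qed (use Suc in auto)
    hence "t - real k * \<delta> \<le> gp (c m) (c b) w" using m Suc.prems by (intro Suc.IH) auto
    moreover have "t - real k * \<delta> \<le> gp (c a) (c m) w" using m Suc.prems by (intro Suc.IH) auto
    ultimately show ?thesis using hyp[where x = "c a" and y = "c b" and w = w and z = "c m"]
      by (auto simp: gp_sym[of "c b"] algebra_simps)
  qed
qed

text \<open>
  At a point p of the geodesic farthest from the path, at distance D, an excursion leaving the
  geodesic at distance 2D on either side of p avoids the D-ball around p, but has length linear
  in D, whereas its length must be exponential in D by the preceding chain estimate.
\<close>

lemma geodesic_near_quasi_path:
  "\<exists>D0. \<forall>c n q. quasi_path l R c n \<and> d (c 0) q + d q (c n) = d (c 0) (c n)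
          \<longrightarrow> (\<exists>i\<le>n. d q (c i) \<le> D0)"
proof -
  obtain D0 where D0: "\<And>D::nat. D > D0 \<Longrightarrow>
      \<exists>k::nat. 6 * l * D + R \<le> 2 ^ k \<and> real l / 2 + (real k + 2) * \<delta> < real D"
    using log_dominated[OF delta_pos, of l R] by blast
  show ?thesis
  proof (rule exI[of _ D0], intro allI impI, elim conjE, rule ccontr)
    fix c n q
    assume qp: "quasi_path l R c n" and q: "d (c 0) q + d q (c n) = d (c 0) (c n)"
      and far: "\<not> (\<exists>i\<le>n. d q (c i) \<le> D0)"
    define m where "m q = Min ((\<lambda>i. d q (c i)) ` {..n})" for q
    have m_le: "m q \<le> d q (c i)" if "i \<le> n" for q i
      unfolding m_def using that by (intro Min_le) auto
    have m_ex: "\<exists>i\<le>n. d q (c i) = m q" for q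
    proof -
      have "m q \<in> (\<lambda>i. d q (c i)) ` {..n}" unfolding m_def by (rule Min_in) auto
      thus ?thesis by auto
    qed
    let ?P = "\<lambda>q. d (c 0) q + d q (c n) = d (c 0) (c n)"
    have "\<forall>y. ?P y \<longrightarrow> m y < Suc (d (c 0) (c n))"
      using m_le[of 0] d_sym by (metis le0 le_add1 le_trans less_Suc_eq_le)
    then obtain p where p: "?P p" and pmax: "\<And>y. ?P y \<Longrightarrow> m y \<le> m p"
      using ex_has_greatest_nat[of ?P q m] q by blast
    define D where "D = m p"
    have "D > D0"
      using pmax[OF q] far m_ex[of q] by (auto simp: D_def)
    have far': "D \<le> d p (c i)" if "i \<le> n" for i using m_le[OF that] by (simp add: D_def)
    have near: "\<exists>i\<le>n. d y (c i) \<le> D" if "?P y" for y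
      using pmax[OF that] m_ex[of y] by (auto simp: D_def)
    \<comment> \<open>Toward the endpoint e, y is the point at distance 2D from p, or e itself if e
      is no farther than that. In the former case the Gromov product is at least (2D + D - D) / 2 =
      D; in the latter y lies on the path and the product is \<open>d p (c i)\<close>.\<close>
    have side: "\<exists>y i. i \<le> n \<and> d y (c i) \<le> D \<and> d y p \<le> 2 * D \<and> real D \<le> gp y (c i) p
        \<and> d e y + d y p = d e p"
      if e: "(e = c 0 \<and> e' = c n) \<or> (e = c n \<and> e' = c 0)" for e e'
    proof (cases "d e p \<le> 2 * D")
      case True
      obtain i where i: "i \<le> n" "e = c i" using e by auto
      have "gp e (c i) p = d p (c i)" using i by (simp add: gp_def)
      then show ?thesis using i True far'[OF i(1)]
        by (intro exI[of _ e] exI[of _ i]) auto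
    next
      case False
      obtain y where y: "d p y = 2 * D" "d y e = d p e - 2 * D"
        using d_geo[of "2 * D" p e] False d_sym by (metis nat_le_linear)
      have ey: "d e y + d y p = d e p" using y False d_sym by (metis le_add_diff_inverse2 nat_le_linear)
      have pe: "d e p + d p e' = d e e'" using e p d_sym by (metis add.commute)
      have "d e y + d y e' = d e e'"
        using ey pe d_tri[of y e' p] d_tri[of e e' y] by linarith
      hence "?P y" using e d_sym by (metis add.commute)
      then obtain i where i: "i \<le> n" "d y (c i) \<le> D" using near by blast
      have "real D \<le> gp y (c i) p" using y(1) i(2) far'[OF i(1)] by (simp add: gp_def)
      then show ?thesis using i ey y d_sym[of y p] by (intro exI[of _ y] exI[of _ i]) auto
    qed
    obtain y i where y: "i \<le> n" "d y (c i) \<le> D" "d y p \<le> 2 * D" "real D \<le> gp y (c i) p"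
        "d (c 0) y + d y p = d (c 0) p" using side[of "c 0" "c n"] by auto
    obtain z j where z: "j \<le> n" "d z (c j) \<le> D" "d z p \<le> 2 * D" "real D \<le> gp z (c j) p"
        "d (c n) z + d z p = d (c n) p" using side[of "c n" "c 0"] by auto
    \<comment> \<open>y and z lie on opposite sides of p between c 0 and c n, so their product at p
      is not positive.\<close>
    have "d y p + d z p \<le> d y z"
      using y(5) z(5) p d_tri[of "c 0" "c n" y] d_tri[of y "c n" z] d_sym[of "c n"] by (auto simp: d_sym)
    hence gyz: "gp y z p \<le> 0" by (simp add: gp_def d_sym[of p])
    \<comment> \<open>The detour through y, p and z has length at most D + 2D + 2D + D; this is the
      6 in \<open>log_dominated\<close>.\<close>
    have dij: "d (c i) (c j) \<le> 6 * D"
      using d_tri[of "c i" "c j" y] d_tri[of y "c j" p] d_tri[of p "c j" z] y z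
        d_sym[of y] d_sym[of z p] by auto
    obtain k where k: "6 * l * D + R \<le> 2 ^ k" "real l / 2 + (real k + 2) * \<delta> < real D"
      using D0[OF \<open>D > D0\<close>] by blast
    have mid: "real D - real l / 2 - real k * \<delta> \<le> gp (c a) (c b) p"
      if ab: "a \<le> b" "b \<le> n" "d (c a) (c b) \<le> 6 * D" for a b
    proof (rule gp_chain)
      show "a \<le> b" by fact
      have "b - a \<le> l * d (c a) (c b) + R" using qp ab by (simp add: quasi_path_def)
      also have "\<dots> \<le> l * (6 * D) + R" using ab by (intro add_mono mult_left_mono) auto
      also have "\<dots> \<le> 2 ^ k" using k by (simp add: algebra_simps)
      finally show "b - a \<le> 2 ^ k" .
      show "real D - real l / 2 \<le> gp (c a) (c a) p"
        using far'[of a] ab by (simp add: gp_def)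
      fix i assume i: "a \<le> i" "i < b"
      have "d (c i) (c (Suc i)) \<le> l" using qp i ab by (simp add: quasi_path_def)
      moreover have "D \<le> d p (c i)" "D \<le> d p (c (Suc i))" using far' i ab by auto
      ultimately show "real D - real l / 2 \<le> gp (c i) (c (Suc i)) p" by (simp add: gp_def)
    qed
    have gij: "real D - real l / 2 - real k * \<delta> \<le> gp (c i) (c j) p"
      using mid[of i j] mid[of j i] y z dij d_sym[of "c i" "c j"] gp_sym[of "c i" "c j"]
      by (cases "i \<le> j") auto
    \<comment> \<open>Passing from y over c i and c j to z takes two applications of hyperbolicity,
      hence the 2 in (k + 2) * \<delta>; the product of y and z at p would come out
      positive.\<close>
    have "min (gp y (c i) p) (gp z (c i) p) - \<delta> \<le> gp y z p" by (rule hyp)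
    moreover have "min (gp z (c j) p) (gp (c i) (c j) p) - \<delta> \<le> gp z (c i) p" by (rule hyp)
    moreover have "real l / 2 + real k * \<delta> + 2 * \<delta> < real D" using k(2) by (simp add: algebra_simps)
    moreover have "real k * \<delta> \<ge> 0" using delta_pos by simp
    moreover have "real l / 2 \<ge> 0" by simp
    ultimately show False using gyz gij y(4) z(4) delta_pos by (simp only: min_def split: if_splits)
  qed
qed

text \<open>Each point of a geodesic is within D0 of the path. Along the geodesic from c 0, nearness
  to the part of the path up to index i gives way to nearness to the part beyond it; at the change
  there are j \<le> i < j' with c j and c j' at distance at most 2 * D0 + 1, so j' - j is bounded
  and c i is close to the geodesic. If no change occurs, c n takes the role of c j'.\<close>

lemma quasi_path_near_geodesic:
  "\<exists>D1. \<forall>c n i. quasi_path l R c n \<and> i \<le> n \<longrightarrow> gp (c 0) (c n) (c i) \<le> real D1"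
proof -
  obtain D0 where D0: "\<And>c n q. quasi_path l R c n \<Longrightarrow> d (c 0) q + d q (c n) = d (c 0) (c n)
          \<Longrightarrow> (\<exists>i\<le>n. d q (c i) \<le> D0)" using geodesic_near_quasi_path[of l R] by blast
  \<comment> \<open>The inner bracket bounds j' - j by the quasi-geodesic inequality, the factor l
    turns indices into distances, and the last D0 leads over to the geodesic.\<close>
  define D1 where "D1 = l * (l * (2 * D0 + 1) + R) + D0"
  show ?thesis
  proof (rule exI[of _ D1], intro allI impI, elim conjE)
    fix c n i assume qp: "quasi_path l R c n" and i: "i \<le> n"
    have st: "\<And>i. i < n \<Longrightarrow> d (c i) (c (Suc i)) \<le> l" using qp by (simp add: quasi_path_def)
    obtain \<gamma> where g: "geodesic (c 0) (c n) \<gamma>" using geodesic_exists by blast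
    define M where "M = d (c 0) (c n)"
    have close: "d (c i) (c j) + D0 \<le> D1"
      if "j \<le> i" "i \<le> j'" "j' \<le> n" "d (c j) (c j') \<le> 2 * D0 + 1" for j j'
    proof -
      have "i - j \<le> j' - j" using that by auto
      also have "\<dots> \<le> l * d (c j) (c j') + R" using qp that by (auto simp: quasi_path_def)
      also have "\<dots> \<le> l * (2 * D0 + 1) + R" using that by (intro add_mono mult_left_mono) auto
      finally have "l * (i - j) \<le> l * (l * (2 * D0 + 1) + R)" by (rule mult_left_mono) simp
      moreover have "d (c j) (c i) \<le> l * (i - j)" using path_dist[of n c l j i] st that by auto
      ultimately have "d (c j) (c i) \<le> l * (l * (2 * D0 + 1) + R)" by (rule order_trans[rotated])
      thus ?thesis by (simp only: D1_def d_sym[of "c i"] add_le_cancel_right)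
    qed
    let ?Q = "\<lambda>a. \<exists>j\<le>i. d (\<gamma> a) (c j) \<le> D0"
    have "\<exists>a\<le>M. d (c i) (\<gamma> a) \<le> D1"
    proof (cases "?Q M")
      case True
      then obtain j where j: "j \<le> i" "d (\<gamma> M) (c j) \<le> D0" by blast
      have "\<gamma> M = c n" using g by (simp add: geodesic_def M_def)
      then show ?thesis using close[of j n] j i d_sym[of "c j" "c n"] d_tri[of "c i" "\<gamma> M" "c j"]
          d_sym[of "c j" "\<gamma> M"]
        by (intro exI[of _ M]) auto
    next
      case False
      have "?Q 0" using g by (auto simp: geodesic_def intro!: exI[of _ 0])
      then obtain a where a: "a < M" "?Q a" "\<not> ?Q (Suc a)"
        using False inc_induct[of 0 M "\<lambda>a. \<not> ?Q a"] by blast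
      obtain j where j: "j \<le> i" "d (\<gamma> a) (c j) \<le> D0" using a by blast
      have "d (c 0) (\<gamma> (Suc a)) + d (\<gamma> (Suc a)) (c n) = d (c 0) (c n)"
        using geodesic_ends[OF g, of "Suc a"] a by (auto simp: M_def)
      then obtain j' where j': "j' \<le> n" "d (\<gamma> (Suc a)) (c j') \<le> D0" using D0[OF qp] by blast
      have "i < j'" using j' a(3) by (meson not_le)
      have "d (\<gamma> a) (\<gamma> (Suc a)) \<le> 1" using g a by (simp add: geodesic_def M_def)
      hence "d (c j) (c j') \<le> 2 * D0 + 1"
        using d_tri[of "c j" "c j'" "\<gamma> a"] d_tri[of "\<gamma> a" "c j'" "\<gamma> (Suc a)"] j j' d_sym[of "c j"] by auto
      hence "d (c i) (c j) + D0 \<le> D1" using close[of j j'] j j' \<open>i < j'\<close> by auto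
      then show ?thesis using d_tri[of "c i" "\<gamma> a" "c j"] j d_sym[of "c j"] a
        by (intro exI[of _ a]) auto
    qed
    then obtain a where a: "a \<le> M" "d (c i) (\<gamma> a) \<le> D1" by blast
    have "d (c i) (c 0) + d (c i) (c n) \<le> 2 * D1 + d (c 0) (c n)"
      using geodesic_ends[OF g, of a] a d_tri[of "c i" "c 0" "\<gamma> a"] d_tri[of "c i" "c n" "\<gamma> a"]
        d_sym[of "\<gamma> a" "c 0"] by (auto simp: M_def)
    thus "gp (c 0) (c n) (c i) \<le> real D1"
      unfolding gp_def by (simp add: field_simps flip: of_nat_add of_nat_mult)
  qed
qed

text \<open>p is compared with a point q of a geodesic at the same distance from c 0. The product of
  c 0 and c n at q vanishes, so hyperbolicity at q bounds d p q by 2 * B + 2 * \<delta>. If p is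
  farther from c 0 than c n is, q = c n serves.\<close>

lemma near_quasi_path_if_gp_small:
  "\<exists>D2. \<forall>c n p. quasi_path l R c n \<and> gp (c 0) (c n) p \<le> B \<longrightarrow> (\<exists>i\<le>n. d p (c i) \<le> D2)"
proof -
  obtain D0 where D0: "\<And>c n q. quasi_path l R c n \<Longrightarrow> d (c 0) q + d q (c n) = d (c 0) (c n)
          \<Longrightarrow> (\<exists>i\<le>n. d q (c i) \<le> D0)" using geodesic_near_quasi_path[of l R] by blast
  show ?thesis
  proof (rule exI[of _ "D0 + nat \<lceil>2 * B + 2 * \<delta>\<rceil>"], intro allI impI, elim conjE)
    fix c n p assume qp: "quasi_path l R c n" and B: "gp (c 0) (c n) p \<le> B"
    have "\<exists>q. d (c 0) q + d q (c n) = d (c 0) (c n) \<and> real (d p q) \<le> 2 * B + 2 * \<delta>"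
    proof (cases "d (c 0) p \<le> d (c 0) (c n)")
      case False
      then show ?thesis using B delta_pos d_sym[of p]
        by (intro exI[of _ "c n"]) (auto simp: gp_def)
    next
      case True
      obtain q where q: "d (c 0) q = d (c 0) p" "d q (c n) = d (c 0) (c n) - d (c 0) p"
        using d_geo[OF True] by blast
      have "min (gp (c 0) p q) (gp (c n) p q) - \<delta> \<le> gp (c 0) (c n) q" by (rule hyp)
      moreover have "gp (c 0) (c n) q = 0"
        using q True by (simp add: gp_def of_nat_diff d_sym[of q "c 0"])
      moreover have "gp (c 0) p q = real (d p q) / 2"
        using q by (simp add: gp_def d_sym[of q "c 0"] d_sym[of q p])
      moreover have "2 * gp (c n) p q = real (d p q) - 2 * gp (c 0) (c n) p"
        using q True by (simp add: gp_def of_nat_diff d_sym[of "c n" p] d_sym[of p "c 0"] d_sym[of q p] field_simps)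
      moreover have "gp (c 0) (c n) p \<ge> 0"
        using d_tri[of "c 0" "c n" p] by (simp add: gp_def d_sym[of "c 0" p])
      ultimately have "real (d p q) \<le> 2 * B + 2 * \<delta>"
        using B by (simp add: min_def split: if_splits)
      thus ?thesis using q True by (intro exI[of _ q]) auto
    qed
    then obtain q where q: "d (c 0) q + d q (c n) = d (c 0) (c n)" "real (d p q) \<le> 2 * B + 2 * \<delta>" by blast
    obtain i where i: "i \<le> n" "d q (c i) \<le> D0" using D0[OF qp q(1)] by blast
    have "d p q \<le> nat \<lceil>2 * B + 2 * \<delta>\<rceil>" using q(2) by linarith
    thus "\<exists>i\<le>n. d p (c i) \<le> D0 + nat \<lceil>2 * B + 2 * \<delta>\<rceil>"
      using i d_tri[of p "c i" q] by (intro exI[of _ i]) auto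
  qed
qed

end

section \<open>Transfer to a second, bi-Lipschitz equivalent metric\<close>

text \<open>\<open>dT\<close> is never shown to be hyperbolic. The product \<open>S.gp\<close> of
  the hyperbolic metric serves as a common test of lying near a geodesic: almost geodesics of
  \<open>dT\<close> pass it, and points that pass it are near every geodesic of
  \<open>dT\<close>.\<close>

locale hyperbolic_pair = S: hyperbolic_nat_metric dS \<delta> + T: geodesic_nat_metric dT
  for dS dT :: "'a \<Rightarrow> 'a \<Rightarrow> nat" and \<delta> +
  fixes l :: nat
  assumes l_pos: "l \<ge> 1"
    and dS_le: "dS x y \<le> l * dT x y"
    and dT_le: "dT x y \<le> l * dS x y"
    and balls: "\<exists>B. \<forall>x. finite {w. dT x w \<le> E} \<and> card {w. dT x w \<le> E} \<le> B"
begin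

text \<open>A path of unit steps that wastes at most R in total wastes at most R on each subpath, so
  it is a quasi-geodesic of \<open>dS\<close> with constants l and R.\<close>

lemma almost_geodesic_gp:
  "\<exists>D. \<forall>c n i. (\<forall>i<n. dT (c i) (c (Suc i)) \<le> 1) \<and> n \<le> dT (c 0) (c n) + R \<and> i \<le> n
     \<longrightarrow> S.gp (c 0) (c n) (c i) \<le> real D"
proof -
  have "S.quasi_path l R c n"
    if st: "\<forall>i<n. dT (c i) (c (Suc i)) \<le> 1" and n: "n \<le> dT (c 0) (c n) + R" for c n
    unfolding S.quasi_path_def
  proof (intro conjI allI impI, goal_cases)
    case (1 i)
    have "dS (c i) (c (Suc i)) \<le> l * dT (c i) (c (Suc i))" by (rule dS_le)
    also have "\<dots> \<le> l * 1" using st 1 by (intro mult_left_mono) auto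
    finally show ?case by simp
  next
    case (2 i j)
    have "dT (c 0) (c i) \<le> i" using T.path_dist[of n c 1 0 i] st 2 by auto
    moreover have "dT (c j) (c n) \<le> n - j" using T.path_dist[of n c 1 j n] st 2 by auto
    moreover have "dT (c 0) (c n) \<le> dT (c 0) (c i) + dT (c i) (c j) + dT (c j) (c n)"
      using T.d_tri[of "c 0" "c n" "c i"] T.d_tri[of "c i" "c n" "c j"] by linarith
    ultimately have "j - i \<le> dT (c i) (c j) + R" using n 2 by linarith
    also have "\<dots> \<le> l * dS (c i) (c j) + R" using dT_le by simp
    finally show ?case .
  qed
  thus ?thesis using S.quasi_path_near_geodesic[of l R] by meson
qed

lemma near_geodesic_if_gp_small:
  "\<exists>E. \<forall>x y p c. S.gp x y p \<le> B \<and> T.geodesic x y c \<longrightarrow> (\<exists>i\<le>dT x y. dT p (c i) \<le> E)"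
proof -
  obtain D where D: "\<And>c n p. S.quasi_path l 0 c n \<Longrightarrow> S.gp (c 0) (c n) p \<le> B \<Longrightarrow> (\<exists>i\<le>n. dS p (c i) \<le> D)"
    using S.near_quasi_path_if_gp_small[of l 0 B] by meson
  show ?thesis
  proof (rule exI[of _ "l * D"], intro allI impI, elim conjE)
    fix x y p c assume gp: "S.gp x y p \<le> B" and c: "T.geodesic x y c"
    have "S.quasi_path l 0 c (dT x y)"
      unfolding S.quasi_path_def
    proof (intro conjI allI impI, goal_cases)
      case (1 i)
      have "dS (c i) (c (Suc i)) \<le> l * dT (c i) (c (Suc i))" by (rule dS_le)
      also have "\<dots> \<le> l * 1" using c 1 by (intro mult_left_mono) (auto simp: T.geodesic_def)
      finally show ?case by simp
    next
      case (2 i j)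
      then show ?case using T.geodesic_dist[OF c, of i j] dT_le[of "c i" "c j"] by simp
    qed
    then obtain i where i: "i \<le> dT x y" "dS p (c i) \<le> D"
      using D[of c "dT x y" p] gp c by (auto simp: T.geodesic_def)
    have "dT p (c i) \<le> l * D" using dT_le[of p "c i"] mult_left_mono[OF i(2), of l] by linarith
    thus "\<exists>i\<le>dT x y. dT p (c i) \<le> l * D" using i by blast
  qed
qed

text \<open>Each point of a geodesic from x to y is near a geodesic from x to z or one from y to z,
  because hyperbolicity makes one of the two products with z small. As x is near the first kind and
  y near the second, some point is near both, and this is the centre. It lies exactly on the
  geodesic from x to y; only the relations to z are approximate.\<close>

lemma tripod_center:
  "\<exists>R. \<forall>x y z. \<exists>w. dT x w + dT w y = dT x y \<and> dT w z + dT x w \<le> dT x z + R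
     \<and> dT w z + dT y w \<le> dT y z + R"
proof -
  obtain D where D: "\<And>c n i. (\<forall>i<n. dT (c i) (c (Suc i)) \<le> 1) \<Longrightarrow> n \<le> dT (c 0) (c n) + 0 \<Longrightarrow> i \<le> n
     \<Longrightarrow> S.gp (c 0) (c n) (c i) \<le> real D"
    using almost_geodesic_gp[of 0] by meson
  obtain E where E: "\<And>x y p c. S.gp x y p \<le> real D + \<delta> \<Longrightarrow> T.geodesic x y c \<Longrightarrow> (\<exists>i\<le>dT x y. dT p (c i) \<le> E)"
    using near_geodesic_if_gp_small[of "real D + \<delta>"] by meson
  show ?thesis
  \<comment> \<open>The centre is within E of one side and, being one step before the change, within
    E + 1 of the other; a detour to a side at distance e adds at most 2 * e.\<close>
  proof (rule exI[of _ "2 * E + 2"], intro allI)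
    fix x y z
    obtain c where c: "T.geodesic x y c" using T.geodesic_exists by blast
    define n where "n = dT x y"
    have c': "c 0 = x" "c n = y" "\<And>i. i < n \<Longrightarrow> dT (c i) (c (Suc i)) \<le> 1"
      using c by (auto simp: T.geodesic_def n_def)
    let ?N = "\<lambda>a i e. \<exists>u. dT a u + dT u z = dT a z \<and> dT (c i) u \<le> e"
    have N: "?N a i E" if gp: "S.gp a z (c i) \<le> real D + \<delta>" for a i
    proof -
      obtain b where b: "T.geodesic a z b" using T.geodesic_exists by blast
      obtain j where "j \<le> dT a z" "dT (c i) (b j) \<le> E" using E[OF gp b] by blast
      thus ?thesis using T.geodesic_ends[OF b, of j] by (intro exI[of _ "b j"]) auto
    qed
    have either: "?N x i E \<or> ?N y i E" if "i \<le> n" for i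
    proof -
      have "S.gp x y (c i) \<le> real D" using D[of n c i] c' that by (auto simp: n_def)
      moreover have "min (S.gp x z (c i)) (S.gp y z (c i)) - \<delta> \<le> S.gp x y (c i)" by (rule S.hyp)
      ultimately show ?thesis using N by (auto simp: min_def split: if_splits)
    qed
    have "\<exists>i\<le>n. ?N x i E \<and> ?N y i (E + 1)"
    proof (cases "?N x n E")
      case True
      moreover have "?N y n (E + 1)" using c' by (intro exI[of _ y]) auto
      ultimately show ?thesis by blast
    next
      case False
      have "?N x 0 E" using c' by (intro exI[of _ x]) auto
      then obtain i where i: "i < n" "?N x i E" "\<not> ?N x (Suc i) E"
        using False inc_induct[of 0 n "\<lambda>a. \<not> ?N x a E"] by blast
      then obtain u where u: "dT y u + dT u z = dT y z" "dT (c (Suc i)) u \<le> E"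
        using either[of "Suc i"] by auto
      have "dT (c i) u \<le> E + 1" using T.d_tri[of "c i" u "c (Suc i)"] c'(3)[OF i(1)] u by linarith
      thus ?thesis using i u by (intro exI[of _ i]) auto
    qed
    then obtain i u v where i: "i \<le> n" and u: "dT x u + dT u z = dT x z" "dT (c i) u \<le> E"
      and v: "dT y v + dT v z = dT y z" "dT (c i) v \<le> E + 1" by blast
    have "dT x (c i) + dT (c i) y = dT x y" using T.geodesic_ends[OF c, of i] i by (auto simp: n_def)
    moreover have "dT (c i) z + dT x (c i) \<le> dT x z + (2 * E + 2)"
      using T.d_tri[of "c i" z u] T.d_tri[of x "c i" u] T.d_sym[of u "c i"] u by linarith
    moreover have "dT (c i) z + dT y (c i) \<le> dT y z + (2 * E + 2)"
      using T.d_tri[of "c i" z v] T.d_tri[of y "c i" v] T.d_sym[of v "c i"] v by linarith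
    ultimately show "\<exists>w. dT x w + dT w y = dT x y \<and> dT w z + dT x w \<le> dT x z + (2 * E + 2)
     \<and> dT w z + dT y w \<le> dT y z + (2 * E + 2)" by blast
  qed
qed

text \<open>The path from x through w to z exceeds \<open>dT x z\<close> by at most R, so w is near
  a fixed geodesic from x to z, at a parameter between j - R - E and j + E; boundedly many balls
  contain all such w. Two inequalities in place of \<open>dT x w = j\<close> admit positions that
  are exact only up to R.\<close>

lemma thin_bigon:
  "\<exists>N. \<forall>x z j. finite {w. dT x w \<le> j \<and> dT w z + j \<le> dT x z + R}
          \<and> card {w. dT x w \<le> j \<and> dT w z + j \<le> dT x z + R} \<le> N"
proof -
  obtain D where D: "\<And>c n i. (\<forall>i<n. dT (c i) (c (Suc i)) \<le> 1) \<Longrightarrow> n \<le> dT (c 0) (c n) + R \<Longrightarrow> i \<le> n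
     \<Longrightarrow> S.gp (c 0) (c n) (c i) \<le> real D"
    using almost_geodesic_gp[of R] by meson
  obtain E where E: "\<And>x y p c. S.gp x y p \<le> real D \<Longrightarrow> T.geodesic x y c \<Longrightarrow> (\<exists>i\<le>dT x y. dT p (c i) \<le> E)"
    using near_geodesic_if_gp_small[of "real D"] by meson
  obtain B where B: "\<And>x. finite {w. dT x w \<le> E}" "\<And>x. card {w. dT x w \<le> E} \<le> B"
    using balls[of E] by auto
  show ?thesis
  proof (rule exI[of _ "(R + 2 * E + 1) * B"], intro allI)
    fix x z j
    obtain b where b: "T.geodesic x z b" using T.geodesic_exists by blast
    let ?I = "{j - R - E..j + E}"
    let ?U = "\<Union>i\<in>?I. {w. dT (b i) w \<le> E}"
    have sub: "{w. dT x w \<le> j \<and> dT w z + j \<le> dT x z + R} \<subseteq> ?U"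
    proof safe
      fix w assume w: "dT x w \<le> j" "dT w z + j \<le> dT x z + R"
      obtain p where p: "T.geodesic x w p" using T.geodesic_exists by blast
      obtain q where q: "T.geodesic w z q" using T.geodesic_exists by blast
      define m where "m = dT x w"
      define n where "n = m + dT w z"
      define c where "c i = (if i \<le> m then p i else q (i - m))" for i
      have e: "c 0 = x" "c m = w" "c n = z"
        using p q by (auto simp: c_def m_def n_def T.geodesic_def)
      have "dT (c i) (c (Suc i)) \<le> 1" if "i < n" for i
      proof (cases i m rule: linorder_cases)
        case less
        then show ?thesis using p by (auto simp: c_def m_def T.geodesic_def)
      next
        case equal
        then show ?thesis using p q that by (auto simp: c_def m_def T.geodesic_def n_def dest!: spec[of _ 0])
      next
        case greater
        then have "i - m < dT w z" using that by (auto simp: n_def)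
        then have "dT (q (i - m)) (q (Suc (i - m))) \<le> 1" using q by (simp add: T.geodesic_def)
        then show ?thesis using greater by (auto simp: c_def Suc_diff_le)
      qed
      moreover have "n \<le> dT (c 0) (c n) + R" using w e by (simp add: n_def m_def)
      ultimately have "S.gp x z w \<le> real D" using D[of n c m] e by (auto simp: n_def)
      then obtain i where i: "i \<le> dT x z" "dT w (b i) \<le> E" using E[OF _ b] by blast
      have bi: "dT x (b i) = i" using T.geodesic_ends[OF b i(1)] by simp
      have "i \<le> j + E" "j \<le> i + R + E"
        using T.d_tri[of x "b i" w] T.d_tri[of x w "b i"] T.d_tri[of x z w] bi w i T.d_sym[of w "b i"]
        by linarith+
      hence "i \<in> ?I" by auto
      thus "w \<in> ?U" using i T.d_sym[of w "b i"] by auto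
    qed
    have fin: "finite ?U" using B by auto
    have "card {w. dT x w \<le> j \<and> dT w z + j \<le> dT x z + R} \<le> card ?U"
      by (rule card_mono[OF fin sub])
    also have "\<dots> \<le> (\<Sum>i\<in>?I. card {w. dT (b i) w \<le> E})" by (rule card_UN_le) simp
    also have "\<dots> \<le> (\<Sum>i\<in>?I. B)" by (rule sum_mono) (rule B)
    also have "\<dots> = card ?I * B" by simp
    also have "\<dots> \<le> (R + 2 * E + 1) * B" by (intro mult_right_mono) auto
    finally show "finite {w. dT x w \<le> j \<and> dT w z + j \<le> dT x z + R}
          \<and> card {w. dT x w \<le> j \<and> dT w z + j \<le> dT x z + R} \<le> (R + 2 * E + 1) * B"
      using finite_subset[OF sub fin] by blast
  qed
qed

end

section \<open>Word metrics\<close>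

lemma sum_list_uminus_rev: "sum_list (rev (map uminus ws)) = - sum_list (ws :: 'g::group_add list)"
  by (induction ws) (auto simp: minus_add)

lemma word_length_witness':
  assumes "generating_set S"
  shows "\<exists>ws. length ws = word_length S g \<and> set ws \<subseteq> S \<union> uminus ` S \<and> sum_list ws = g"
proof -
  obtain ws where "set ws \<subseteq> S \<union> uminus ` S \<and> sum_list ws = g"
    using assms unfolding generating_set_def by blast
  hence "\<exists>n ws. length ws = n \<and> set ws \<subseteq> S \<union> uminus ` S \<and> sum_list ws = g" by blast
  from LeastI_ex[OF this] show ?thesis unfolding word_length_def .
qed

context
  fixes S :: "'g::group_add set"
  assumes gen: "generating_set S"
begin

lemmas word_length_witness = word_length_witness'[OF gen]

lemma word_length_le:
  "set ws \<subseteq> S \<union> uminus ` S \<Longrightarrow> word_length S (sum_list ws) \<le> length ws"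
  unfolding word_length_def by (rule Least_le) auto

lemma word_length_0: "word_length S 0 = 0"
  using word_length_le[of "[]"] by simp

lemma word_length_eq_0: "word_length S g = 0 \<Longrightarrow> g = 0"
  using word_length_witness[of g] by auto

lemma word_length_add: "word_length S (g + h) \<le> word_length S g + word_length S h"
proof -
  obtain u v where "length u = word_length S g" "set u \<subseteq> S \<union> uminus ` S" "sum_list u = g"
     "length v = word_length S h" "set v \<subseteq> S \<union> uminus ` S" "sum_list v = h"
    using word_length_witness by metis
  thus ?thesis using word_length_le[of "u @ v"] by auto
qed

lemma word_length_uminus_le: "word_length S (- g) \<le> word_length S g"
proof -
  obtain u where u: "length u = word_length S g" "set u \<subseteq> S \<union> uminus ` S" "sum_list u = g"
    using word_length_witness by metis
  have "set (rev (map uminus u)) \<subseteq> S \<union> uminus ` S" using u(2) by auto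
  from word_length_le[OF this] show ?thesis using u by (simp only: sum_list_uminus_rev length_rev length_map)
qed

lemma word_length_uminus: "word_length S (- g) = word_length S g"
  using word_length_uminus_le[of g] word_length_uminus_le[of "- g"] by simp

lemma word_length_split:
  assumes "k \<le> word_length S g"
  shows "\<exists>u. word_length S u = k \<and> word_length S (- u + g) = word_length S g - k"
proof -
  obtain u where u: "length u = word_length S g" "set u \<subseteq> S \<union> uminus ` S" "sum_list u = g"
    using word_length_witness by metis
  let ?a = "sum_list (take k u)" and ?b = "sum_list (drop k u)"
  have g: "g = ?a + ?b" using u(3) by (metis append_take_drop_id sum_list_append)
  have "word_length S ?a \<le> k" using word_length_le[of "take k u"] u assms set_take_subset[of k u] by auto
  moreover have "word_length S ?b \<le> word_length S g - k"
    using word_length_le[of "drop k u"] u set_drop_subset[of k u] by auto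
  moreover have "- ?a + g = ?b" using g by (simp add: add.assoc[symmetric])
  moreover have "word_length S g \<le> word_length S ?a + word_length S ?b"
    using word_length_add[of ?a ?b] g by simp
  ultimately have "word_length S ?a = k \<and> word_length S (- ?a + g) = word_length S g - k"
    using assms by (simp only: conj_imp_eq_imp_imp) linarith
  thus ?thesis by blast
qed

lemma geodesic_nat_metric_word: "geodesic_nat_metric (\<lambda>x y. word_length S (- x + y))"
proof
  fix x y z :: 'g and k
  show "word_length S (- x + x) = 0" by (simp add: word_length_0)
  show "x = y" if "word_length S (- x + y) = 0"
    using word_length_eq_0[OF that] by (metis add.right_neutral add_minus_cancel)
  show "word_length S (- x + y) = word_length S (- y + x)"
    using word_length_uminus[of "- x + y"] by (simp add: minus_add)
  show "word_length S (- x + z) \<le> word_length S (- x + y) + word_length S (- y + z)"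
    using word_length_add[of "- x + y" "- y + z"] by (simp add: add.assoc)
  assume "k \<le> word_length S (- x + y)"
  from word_length_split[OF this] obtain u where
    "word_length S u = k" "word_length S (- u + (- x + y)) = word_length S (- x + y) - k" by blast
  thus "\<exists>z. word_length S (- x + z) = k \<and> word_length S (- z + y) = word_length S (- x + y) - k"
    by (intro exI[of _ "x + u"]) (simp add: minus_add add.assoc[symmetric])
qed

lemma finite_word_ball:
  assumes "finite S"
  shows "finite {g. word_length S g \<le> n}"
proof (rule finite_subset)
  show "{g. word_length S g \<le> n} \<subseteq> sum_list ` {ws. set ws \<subseteq> S \<union> uminus ` S \<and> length ws \<le> n}"
  proof
    fix g assume "g \<in> {g. word_length S g \<le> n}"
    moreover obtain ws where "length ws = word_length S g" "set ws \<subseteq> S \<union> uminus ` S" "sum_list ws = g"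
      using word_length_witness by metis
    ultimately show "g \<in> sum_list ` {ws. set ws \<subseteq> S \<union> uminus ` S \<and> length ws \<le> n}"
      by (intro image_eqI[of _ _ ws]) auto
  qed
  show "finite (sum_list ` {ws. set ws \<subseteq> S \<union> uminus ` S \<and> length ws \<le> n})"
    using assms by (intro finite_imageI finite_lists_length_le) auto
qed

text \<open>Each letter of T is spelled out in letters of S, and l bounds the length of these
  spellings; the inserted 0 covers an empty T.\<close>

lemma word_length_bilipschitz:
  assumes "finite T" "generating_set T"
  shows "\<exists>l. \<forall>g. word_length S g \<le> l * word_length T g"
proof -
  define l where "l = Max (insert 0 (word_length S ` (T \<union> uminus ` T)))"
  have l: "word_length S t \<le> l" if "t \<in> T \<union> uminus ` T" for t
    unfolding l_def using assms that by (intro Max_ge) auto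
  have *: "word_length S (sum_list ws) \<le> l * length ws" if "set ws \<subseteq> T \<union> uminus ` T" for ws
    using that
  proof (induction ws)
    case (Cons a ws)
    then show ?case using word_length_add[of a "sum_list ws"] l[of a] by simp
  qed (simp add: word_length_0)
  show ?thesis
  proof (rule exI[of _ l], intro allI)
    fix g
    obtain ws where "length ws = word_length T g" "set ws \<subseteq> T \<union> uminus ` T" "sum_list ws = g"
      using word_length_witness'[OF assms(2)] by metis
    with *[of ws] show "word_length S g \<le> l * word_length T g" by auto
  qed
qed

end

lemma hyperbolic_group_pair:
  assumes "gromov_hyperbolic_group TYPE('g::group_add)" "finite T" "generating_set (T :: 'g set)"
  shows "\<exists>(S::'g set) \<delta> l. hyperbolic_pair (\<lambda>x y. word_length S (- x + y)) (\<lambda>x y. word_length T (- x + y)) \<delta> l"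
proof -
  obtain S :: "'g set" and \<delta> where S: "finite S" "generating_set S" "\<delta> \<ge> 0"
    and hyp: "\<And>x y z w. gromov_product S x y w \<ge> min (gromov_product S x z w) (gromov_product S y z w) - \<delta>"
    using assms unfolding gromov_hyperbolic_group_def by blast
  obtain l1 where l1: "\<And>g. word_length S g \<le> l1 * word_length T g"
    using word_length_bilipschitz[OF S(2) assms(2,3)] by blast
  obtain l2 where l2: "\<And>g. word_length T g \<le> l2 * word_length S g"
    using word_length_bilipschitz[OF assms(3) S(1,2)] by blast
  define l where "l = l1 + l2 + 1"
  interpret S: geodesic_nat_metric "\<lambda>x y. word_length S (- x + y)"
    by (rule geodesic_nat_metric_word) fact
  interpret T: geodesic_nat_metric "\<lambda>x y. word_length T (- x + y)"
    by (rule geodesic_nat_metric_word) fact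
  have gp: "S.gp x y w = gromov_product S x y w" for x y w
    by (simp add: S.gp_def gromov_product_def word_metric_def)
  \<comment> \<open>\<delta> is enlarged to be positive, as \<open>log_dominated\<close> requires,
    and l is a Lipschitz constant in both directions.\<close>
  have "hyperbolic_pair (\<lambda>x y. word_length S (- x + y)) (\<lambda>x y. word_length T (- x + y)) (\<delta> + 1) l"
  proof (unfold_locales, goal_cases)
    case 1 show ?case using S by simp
  next
    case (2 x z w y) show ?case using hyp[of x z w y] by (simp add: gp)
  next
    case 3 show ?case by (simp add: l_def)
  next
    case (4 x y) show ?case using l1[of "- x + y"] by (simp add: l_def algebra_simps)
  next
    case (5 x y) show ?case using l2[of "- x + y"] by (simp add: l_def algebra_simps)
  next
    case (6 E)
    have fin: "finite {g. word_length T g \<le> E}" by (rule finite_word_ball) fact+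
    \<comment> \<open>Balls are left translates of the ball at the identity, so their size does not
      depend on the centre.\<close>
    have eq: "{w. word_length T (- x + w) \<le> E} = (+) x ` {g. word_length T g \<le> E}" for x :: 'g
    proof safe
      fix w assume "word_length T (- x + w) \<le> E"
      thus "w \<in> (+) x ` {g. word_length T g \<le> E}"
        by (intro image_eqI[of _ _ "- x + w"]) (auto simp: add.assoc[symmetric])
    qed (simp add: add.assoc[symmetric])
    show ?case
      by (rule exI[of _ "card {g. word_length T g \<le> E}"]) (use fin in \<open>auto simp: eq card_image_le\<close>)
  qed
  thus ?thesis by blast
qed

section \<open>Factorization of the kernel\<close>

text \<open>Adding or removing one element a pairs subsets of opposite sign.\<close>

lemma sum_Pow_signs:
  assumes "finite E"
  shows "(\<Sum>\<omega>\<in>Pow E. (-1) ^ card \<omega>) = (if E = {} then 1 else 0 :: real)"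
  using assms
proof (induction E)
  case (insert a E)
  have disj: "Pow E \<inter> insert a ` Pow E = {}" using insert by auto
  have inj: "inj_on (insert a) (Pow E)"
    using insert by (intro inj_onI) (metis Diff_insert_absorb PowD subsetD)
  have "(\<Sum>\<omega>\<in>insert a ` Pow E. (-1::real) ^ card \<omega>) = (\<Sum>\<omega>\<in>Pow E. (-1) ^ card (insert a \<omega>))"
    by (simp add: sum.reindex[OF inj])
  also have "\<dots> = (\<Sum>\<omega>\<in>Pow E. - ((-1) ^ card \<omega>))"
  proof (rule sum.cong)
    fix \<omega> assume "\<omega> \<in> Pow E"
    hence "finite \<omega>" "a \<notin> \<omega>" using insert finite_subset by auto
    thus "(-1::real) ^ card (insert a \<omega>) = - ((-1) ^ card \<omega>)" by simp
  qed simp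
  finally show ?case using insert disj
    by (simp add: Pow_insert sum.union_disjoint sum_negf)
qed simp

text \<open>For nonempty \<omega> the k with \<omega> \<subseteq> A k lie within m of the least one,
  so Cauchy-Schwarz costs only a factor m + 1; summing over \<omega> then counts at most 2^K subsets
  for each k. This near orthogonality leaves one factor 1 / (1 - r) where two would be
  expected.\<close>

lemma sum_window_squares:
  fixes f :: "nat \<Rightarrow> 'b set \<Rightarrow> real"
  assumes f: "\<And>k \<omega>. \<bar>f k \<omega>\<bar> \<le> (if \<omega> \<subseteq> A k \<and> \<omega> \<noteq> {} then 1 else 0)"
    and A: "\<And>k. finite (A k)" "\<And>k. card (A k) \<le> K"
    and near: "\<And>k k'. A k \<inter> A k' \<noteq> {} \<Longrightarrow> k' \<le> k + m"
    and r: "0 < r" "r < 1" and \<Omega>: "finite \<Omega>"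
  shows "(\<Sum>\<omega>\<in>\<Omega>. (\<Sum>k\<le>M. r ^ k * f k \<omega>)\<^sup>2) \<le> real ((m + 1) * 2 ^ K) / (1 - r)"
proof -
  have one: "(\<Sum>k\<le>M. r ^ k * f k \<omega>)\<^sup>2 \<le> (\<Sum>k\<le>M. real (m + 1) * (r ^ k * (if \<omega> \<subseteq> A k \<and> \<omega> \<noteq> {} then 1 else 0)))" for \<omega>
  proof -
    define S where "S = {k\<in>{..M}. \<omega> \<subseteq> A k \<and> \<omega> \<noteq> {}}"
    have fS: "finite S" by (simp add: S_def)
    have cS: "card S \<le> m + 1"
    proof (cases "S = {}")
      case False
      have "S \<subseteq> {Min S..Min S + m}"
      proof
        fix k assume k: "k \<in> S"
        have "Min S \<in> S" using False fS by simp
        moreover have "\<omega> \<subseteq> A j \<and> \<omega> \<noteq> {}" if "j \<in> S" for j using that by (auto simp: S_def)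
        ultimately have "A (Min S) \<inter> A k \<noteq> {}" using k by blast
        from near[OF this] show "k \<in> {Min S..Min S + m}" using k fS by simp
      qed
      hence "card S \<le> card {Min S..Min S + m}" by (intro card_mono) auto
      thus ?thesis by simp
    qed simp
    have f0: "f k \<omega> = 0" if "k \<le> M" "k \<notin> S" for k using f[of k \<omega>] that by (simp add: S_def split: if_splits)
    have "(\<Sum>k\<le>M. r ^ k * f k \<omega>) = (\<Sum>k\<in>S. r ^ k * f k \<omega>)"
      using f0 by (intro sum.mono_neutral_right) (auto simp: S_def)
    also have "\<dots>\<^sup>2 \<le> (\<Sum>k\<in>S. (r ^ k * f k \<omega>)\<^sup>2) * real (card S)"
      by (rule sum_squared_le_sum_of_squares)
    also have "\<dots> \<le> (\<Sum>k\<in>S. r ^ k) * real (m + 1)"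
    proof (intro mult_mono sum_mono sum_nonneg)
      fix k
      have "\<bar>f k \<omega>\<bar> \<le> 1" using f[of k \<omega>] by (auto split: if_splits)
      hence "\<bar>r ^ k * f k \<omega>\<bar> \<le> r ^ k" using r by (simp add: abs_mult mult_left_le)
      moreover have rk: "0 \<le> r ^ k" "r ^ k \<le> 1" using r by (auto intro: power_le_one)
      ultimately have "\<bar>r ^ k * f k \<omega>\<bar>\<^sup>2 \<le> (r ^ k)\<^sup>2" by (intro power_mono) auto
      also have "\<dots> \<le> r ^ k" using rk by (simp add: power2_eq_square mult_left_le)
      finally show "(r ^ k * f k \<omega>)\<^sup>2 \<le> r ^ k" by simp
    qed (use cS r in auto)
    also have "(\<Sum>k\<in>S. r ^ k) = (\<Sum>k\<le>M. r ^ k * (if \<omega> \<subseteq> A k \<and> \<omega> \<noteq> {} then 1 else 0))"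
      unfolding S_def by (subst sum.inter_filter) (auto intro!: sum.cong)
    finally show ?thesis by (simp add: sum_distrib_left sum_distrib_right mult_ac)
  qed
  have "(\<Sum>\<omega>\<in>\<Omega>. (\<Sum>k\<le>M. r ^ k * f k \<omega>)\<^sup>2)
      \<le> (\<Sum>\<omega>\<in>\<Omega>. \<Sum>k\<le>M. real (m + 1) * (r ^ k * (if \<omega> \<subseteq> A k \<and> \<omega> \<noteq> {} then 1 else 0)))"
    by (intro sum_mono one)
  also have "\<dots> = (\<Sum>k\<le>M. real (m + 1) * r ^ k * (\<Sum>\<omega>\<in>\<Omega>. if \<omega> \<subseteq> A k \<and> \<omega> \<noteq> {} then 1 else 0))"
    by (subst sum.swap) (simp add: sum_distrib_left mult_ac)
  also have "\<dots> \<le> (\<Sum>k\<le>M. real (m + 1) * r ^ k * 2 ^ K)"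
  proof (intro sum_mono mult_left_mono)
    fix k
    have "(\<Sum>\<omega>\<in>\<Omega>. if \<omega> \<subseteq> A k \<and> \<omega> \<noteq> {} then 1 else 0 :: real) = real (card {\<omega>\<in>\<Omega>. \<omega> \<subseteq> A k \<and> \<omega> \<noteq> {}})"
      using \<Omega> by (simp add: sum.inter_filter[symmetric])
    also have "\<dots> \<le> real (card (Pow (A k)))" using A by (intro of_nat_mono card_mono) auto
    also have "\<dots> = 2 ^ card (A k)" using A by (simp add: card_Pow)
    also have "\<dots> \<le> 2 ^ K" using A by (intro power_increasing) auto
    finally show "(\<Sum>\<omega>\<in>\<Omega>. if \<omega> \<subseteq> A k \<and> \<omega> \<noteq> {} then 1 else 0 :: real) \<le> 2 ^ K" .
  qed (use r in auto)
  also have "\<dots> = real (m + 1) * 2 ^ K * (\<Sum>k\<le>M. r ^ k)"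
    by (simp add: sum_distrib_left sum_distrib_right mult_ac)
  also have "\<dots> \<le> real (m + 1) * 2 ^ K * (1 / (1 - r))"
  proof (intro mult_left_mono)
    have "(\<Sum>k\<le>M. r ^ k) = (1 - r ^ Suc M) / (1 - r)" using r by (simp add: sum_gp0)
    also have "\<dots> \<le> 1 / (1 - r)" using r by (intro divide_right_mono) auto
    finally show "(\<Sum>k\<le>M. r ^ k) \<le> 1 / (1 - r)" .
  qed simp
  finally show ?thesis by (simp add: algebra_simps add_divide_distrib)
qed

section \<open>Vectors representing the kernel\<close>

text \<open>The counting bound has slack \<open>Suc R\<close>, one more than \<open>center\<close>,
  because an odd excess n - d x y cannot be divided evenly between x and y.\<close>

locale tripod_metric = geodesic_nat_metric d for d :: "'a \<Rightarrow> 'a \<Rightarrow> nat" +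
  fixes z :: 'a and R N :: nat
  assumes center: "\<exists>w. d x w + d w y = d x y \<and> d w z + d x w \<le> d x z + R \<and> d w z + d y w \<le> d y z + R"
    and bigon: "finite {w. d x w \<le> j \<and> d w z + j \<le> d x z + Suc R}"
      "card {w. d x w \<le> j \<and> d w z + j \<le> d x z + Suc R} \<le> N"
begin

text \<open>
  The space is extended by a ray starting at z, with Inr j at distance j from z, so that the path
  from x through z never ends. Up to a bounded error, cells x k is the position of that path after
  k steps.
\<close>

definition cells :: "'a \<Rightarrow> nat \<Rightarrow> ('a + nat) set" where
  "cells x k = Inl ` {w. d x w \<le> k \<and> d w z + k \<le> d x z + Suc R}
     \<union> Inr ` {j. d x z + j \<le> k \<and> k \<le> d x z + j + Suc R}"

lemma finite_cells: "finite (cells x k)"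
  and card_cells: "card (cells x k) \<le> N + R + 2"
proof -
  let ?A = "{w. d x w \<le> k \<and> d w z + k \<le> d x z + Suc R}"
  let ?B = "{j. d x z + j \<le> k \<and> k \<le> d x z + j + Suc R}"
  have sub: "?B \<subseteq> {k - d x z - Suc R..k - d x z}" by auto
  have fB: "finite ?B" by (rule finite_subset[OF sub]) simp
  have "card ?B \<le> card {k - d x z - Suc R..k - d x z}" by (rule card_mono[OF _ sub]) simp
  hence cB: "card ?B \<le> R + 2" by simp
  show "finite (cells x k)" using bigon fB by (simp add: cells_def)
  have "card (cells x k) \<le> card (Inl ` ?A :: ('a + nat) set) + card (Inr ` ?B :: ('a + nat) set)"
    unfolding cells_def by (rule card_Un_le)
  also have "\<dots> = card ?A + card ?B" by (simp add: card_image)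
  finally show "card (cells x k) \<le> N + R + 2" using cB bigon(2)[of x k] by linarith
qed

lemma cells_near:
  assumes "t \<in> cells x k" "t \<in> cells x k'"
  shows "k' \<le> k + Suc R"
  using assms
proof (cases t)
  case (Inl w)
  then show ?thesis using assms d_tri[of x z w] by (auto simp: cells_def)
qed (auto simp: cells_def)

text \<open>Let the height of a cell be d w z for \<open>Inl w\<close> and -j for
  \<open>Inr j\<close>. A cell in \<open>cells x k\<close> has height between d x z - k and d x z -
  k + R + 1, and likewise for y and l; the two ranges must overlap.\<close>

lemma cells_level:
  assumes "t \<in> cells x k" "t \<in> cells y l"
  shows "d x z + l \<le> k + d y z + Suc R"
  using assms
proof (cases t)
  case (Inl w)
  then show ?thesis using assms d_tri[of x z w] by (auto simp: cells_def)
qed (auto simp: cells_def)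

text \<open>The level estimates for t and t' bound n - 2 * k from above and n - 2 * k' from below;
  adding them gives 2 * (k' - k) \<le> 2 * (R + 1).\<close>

lemma cells_window:
  assumes "t \<in> cells x k" "t \<in> cells y (n - k)" "t' \<in> cells x k'" "t' \<in> cells y (n - k')" "k \<le> n" "k' \<le> n"
  shows "k' \<le> k + Suc R"
  using cells_level[OF assms(1,2)] cells_level[OF assms(4,3)] assms(5,6) by linarith

text \<open>Paths from x and from y reach the tripod centre w and then run on together toward z. The
  excess n - d x y is used up by walking s steps beyond w from both sides; for large n this
  overshoots z and ends on the ray.\<close>

lemma cells_meet_iff: "(\<exists>k\<le>n. cells x k \<inter> cells y (n - k) \<noteq> {}) \<longleftrightarrow> d x y \<le> n"
proof
  assume "\<exists>k\<le>n. cells x k \<inter> cells y (n - k) \<noteq> {}"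
  then obtain k t where k: "k \<le> n" "t \<in> cells x k" "t \<in> cells y (n - k)" by blast
  show "d x y \<le> n"
  proof (cases t)
    case (Inl w)
    then show ?thesis using k d_tri[of x y w] d_sym[of w y] by (auto simp: cells_def)
  next
    case (Inr j)
    then show ?thesis using k d_tri[of x y z] d_sym[of z y] by (auto simp: cells_def)
  qed
next
  assume n: "d x y \<le> n"
  obtain w where w: "d x w + d w y = d x y" "d w z + d x w \<le> d x z + R" "d w z + d y w \<le> d y z + R"
    using center by blast
  \<comment> \<open>Half of the excess; an odd remainder is left to y.\<close>
  define s where "s = (n - d x y) div 2"
  define k where "k = d x w + s"
  have s: "d x y + 2 * s \<le> n" "n \<le> d x y + 2 * s + 1" using n by (auto simp: s_def)
  have l: "k \<le> n" "d y w + s \<le> n - k" "n - k \<le> d y w + s + 1"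
    using s w(1) d_sym[of w y] by (auto simp: k_def)
  have "cells x k \<inter> cells y (n - k) \<noteq> {}"
  proof (cases "s \<le> d w z")
    case True
    obtain v where v: "d w v = s" "d v z = d w z - s" using d_geo[OF True] by blast
    have "Inl v \<in> cells x k \<inter> cells y (n - k)"
      using v l w True d_tri[of x v w] d_tri[of y v w] by (auto simp: cells_def k_def)
    thus ?thesis by blast
  next
    case False
    have "Inr (s - d w z) \<in> cells x k \<inter> cells y (n - k)"
      using l w False d_tri[of x z w] d_tri[of y z w] by (auto simp: cells_def k_def)
    thus ?thesis by blast
  qed
  thus "\<exists>k\<le>n. cells x k \<inter> cells y (n - k) \<noteq> {}" using l by blast
qed

text \<open>
  For fixed n, the k for which cells x k meets cells y (n - k) lie in a window of length R + 1, and
  the last of them is singled out by looking ahead R + 1 steps. The index i records the step, so that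
  disjointness of fwd x k and bwd y l excludes all these k at once; disjointness of two finite
  sets is the alternating sum over the common subsets, which is an inner product.
  Restricting to subsets meeting index 0 subtracts the indicator with i = 0 from the one without.
\<close>

definition fwd :: "'a \<Rightarrow> nat \<Rightarrow> (nat \<times> ('a + nat)) set" where
  "fwd x k = (SIGMA i:{..Suc R}. cells x (k + i))"

definition bwd :: "'a \<Rightarrow> nat \<Rightarrow> (nat \<times> ('a + nat)) set" where
  "bwd y l = (SIGMA i:{i. i \<le> Suc R \<and> i \<le> l}. cells y (l - i))"

definition fwd_vec :: "'a \<Rightarrow> nat \<Rightarrow> (nat \<times> ('a + nat)) set \<Rightarrow> real" where
  "fwd_vec x k \<omega> = (if \<omega> \<subseteq> fwd x k \<and> 0 \<in> fst ` \<omega> then 1 else 0)"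

definition bwd_vec :: "'a \<Rightarrow> nat \<Rightarrow> (nat \<times> ('a + nat)) set \<Rightarrow> real" where
  "bwd_vec y l \<omega> = (if \<omega> \<subseteq> bwd y l \<and> 0 \<in> fst ` \<omega> then - ((-1) ^ card \<omega>) else 0)"

lemma finite_fwd: "finite (fwd x k)" and card_fwd: "card (fwd x k) \<le> (R + 2) * (N + R + 2)"
proof -
  show "finite (fwd x k)" unfolding fwd_def using finite_cells by auto
  have "card (fwd x k) = (\<Sum>i\<in>{..Suc R}. card (cells x (k + i)))"
    unfolding fwd_def using finite_cells by (subst card_SigmaI) auto
  also have "\<dots> \<le> (\<Sum>i\<in>{..Suc R}. N + R + 2)" by (intro sum_mono card_cells)
  finally show "card (fwd x k) \<le> (R + 2) * (N + R + 2)" by simp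
qed

lemma finite_bwd: "finite (bwd x k)" and card_bwd: "card (bwd x k) \<le> (R + 2) * (N + R + 2)"
proof -
  let ?I = "{i. i \<le> Suc R \<and> i \<le> k}"
  have sub: "?I \<subseteq> {..Suc R}" by auto
  have fI: "finite ?I" by (rule finite_subset[OF sub]) simp
  have cI: "card ?I \<le> R + 2" using card_mono[OF _ sub] by simp
  show "finite (bwd x k)" unfolding bwd_def using finite_cells fI by auto
  have "card (bwd x k) = (\<Sum>i\<in>?I. card (cells x (k - i)))"
    unfolding bwd_def using finite_cells fI by (subst card_SigmaI) auto
  also have "\<dots> \<le> (\<Sum>i\<in>?I. N + R + 2)" by (intro sum_mono card_cells)
  also have "\<dots> = card ?I * (N + R + 2)" by simp
  also have "\<dots> \<le> (R + 2) * (N + R + 2)" using cI by (rule mult_right_mono) simp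
  finally show "card (bwd x k) \<le> (R + 2) * (N + R + 2)" .
qed

definition meets :: "'a \<Rightarrow> 'a \<Rightarrow> nat \<Rightarrow> nat \<Rightarrow> bool" where
  "meets x y n k \<longleftrightarrow> k \<le> n \<and> cells x k \<inter> cells y (n - k) \<noteq> {}"

text \<open>The subsets with nonzero product are the subsets of E =
  \<open>fwd x k \<inter> bwd y (n - k)\<close> that meet index 0, that is
  \<open>Pow E - Pow E1\<close>, where E1 drops index 0. The sum is the indicator of E1 = {} minus
  that of E = {}, which is 1 just when there is a meeting at k and none in the next R + 1
  steps.\<close>

lemma sum_fwd_bwd:
  assumes \<Omega>: "finite \<Omega>" "Pow (fwd x k) \<subseteq> \<Omega>" and k: "k \<le> n"
  shows "(\<Sum>\<omega>\<in>\<Omega>. fwd_vec x k \<omega> * bwd_vec y (n - k) \<omega>) =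
     (if meets x y n k \<and> (\<forall>i\<in>{1..Suc R}. \<not> meets x y n (k + i)) then 1 else 0)"
proof -
  define E where "E = fwd x k \<inter> bwd y (n - k)"
  define E1 where "E1 = {p\<in>E. fst p \<noteq> 0}"
  have fin: "finite E" "finite E1" using finite_fwd by (auto simp: E_def E1_def)
  \<comment> \<open>The bound i \<le> n - k built into \<open>bwd\<close> excludes truncated
    subtraction, so index i of E records genuine meetings at step k + i \<le> n.\<close>
  have E_meets: "(i, t) \<in> E \<longleftrightarrow> i \<le> Suc R \<and> k + i \<le> n \<and> t \<in> cells x (k + i) \<inter> cells y (n - (k + i))" for i t
    using k by (auto simp: E_def fwd_def bwd_def diff_diff_left)
  have "E = {} \<longleftrightarrow> (\<forall>i t. (i, t) \<notin> E)" by auto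
  also have "\<dots> \<longleftrightarrow> (\<forall>i\<in>{..Suc R}. \<not> meets x y n (k + i))"
    unfolding meets_def E_meets by blast
  also have "{..Suc R} = insert 0 {1..Suc R}" by auto
  finally have EE: "E = {} \<longleftrightarrow> \<not> meets x y n k \<and> (\<forall>i\<in>{1..Suc R}. \<not> meets x y n (k + i))"
    by simp
  have "E1 = {} \<longleftrightarrow> (\<forall>i t. i \<noteq> 0 \<longrightarrow> (i, t) \<notin> E)" by (auto simp: E1_def)
  also have "\<dots> \<longleftrightarrow> (\<forall>i. i \<noteq> 0 \<and> i \<le> Suc R \<longrightarrow> \<not> meets x y n (k + i))"
    unfolding meets_def E_meets by blast
  finally have EE1: "E1 = {} \<longleftrightarrow> (\<forall>i\<in>{1..Suc R}. \<not> meets x y n (k + i))"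
    by (auto simp: Suc_le_eq)
  have summand: "fwd_vec x k \<omega> * bwd_vec y (n - k) \<omega> =
      (if \<omega> \<subseteq> E \<and> 0 \<in> fst ` \<omega> then - ((-1) ^ card \<omega>) else 0)" for \<omega>
    by (simp add: fwd_vec_def bwd_vec_def E_def)
  have "0 \<notin> fst ` \<omega> \<longleftrightarrow> (\<forall>p\<in>\<omega>. fst p \<noteq> 0)" for \<omega> :: "(nat \<times> ('a + nat)) set"
    by (metis (no_types, lifting) image_iff)
  hence "\<omega> \<subseteq> E1 \<longleftrightarrow> \<omega> \<subseteq> E \<and> 0 \<notin> fst ` \<omega>" for \<omega>
    unfolding E1_def by blast
  hence dom: "\<omega> \<in> Pow E - Pow E1 \<longleftrightarrow> \<omega> \<subseteq> E \<and> 0 \<in> fst ` \<omega>" for \<omega> by blast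
  have "(\<Sum>\<omega>\<in>\<Omega>. fwd_vec x k \<omega> * bwd_vec y (n - k) \<omega>)
      = (\<Sum>\<omega>\<in>Pow E - Pow E1. - ((-1) ^ card \<omega>))"
  proof (rule sum.mono_neutral_cong_right)
    show "Pow E - Pow E1 \<subseteq> \<Omega>" using \<Omega> by (auto simp: E_def)
    show "\<forall>\<omega>\<in>\<Omega> - (Pow E - Pow E1). fwd_vec x k \<omega> * bwd_vec y (n - k) \<omega> = 0"
      using dom summand by simp
    show "fwd_vec x k \<omega> * bwd_vec y (n - k) \<omega> = - ((-1) ^ card \<omega>)" if "\<omega> \<in> Pow E - Pow E1" for \<omega>
      using that dom[of \<omega>] summand[of \<omega>] by simp
  qed fact
  also have "\<dots> = (\<Sum>\<omega>\<in>Pow E1. (-1) ^ card \<omega>) - (\<Sum>\<omega>\<in>Pow E. (-1) ^ card \<omega>)"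
    using fin by (subst sum_diff) (auto simp: sum_negf E1_def)
  also have "\<dots> = (if E1 = {} then 1 else 0) - (if E = {} then 1 else 0)"
    using fin by (simp add: sum_Pow_signs)
  finally show ?thesis using EE EE1 by auto
qed

definition last_meet :: "'a \<Rightarrow> 'a \<Rightarrow> nat \<Rightarrow> nat \<Rightarrow> real" where
  "last_meet x y k l = (if meets x y (k + l) k \<and> (\<forall>i\<in>{1..Suc R}. \<not> meets x y (k + l) (k + i)) then 1 else 0)"

text \<open>All meeting indices lie in a window of length R + 1, so one that is followed by none
  among the next R + 1 is the largest. Hence a single k is counted as soon as there is any
  meeting.\<close>

lemma sum_last_meet: "(\<Sum>k\<le>n. last_meet x y k (n - k)) = (if d x y \<le> n then 1 else 0)"
proof -
  define K where "K = {k. meets x y n k}"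
  have K: "finite K" by (rule finite_subset[of _ "{..n}"]) (auto simp: K_def meets_def)
  have Kn: "K \<noteq> {} \<longleftrightarrow> d x y \<le> n"
    using cells_meet_iff[of n x y] by (auto simp: K_def meets_def)
  have win: "k' \<le> k + Suc R" if "k \<in> K" "k' \<in> K" for k k'
    using that cells_window[of _ x k y n _ k'] by (auto simp: K_def meets_def)
  have eq: "last_meet x y k (n - k) = (if K \<noteq> {} \<and> k = Max K then 1 else 0)" if "k \<le> n" for k
  proof -
    have "(meets x y n k \<and> (\<forall>i\<in>{1..Suc R}. \<not> meets x y n (k + i))) \<longleftrightarrow> K \<noteq> {} \<and> k = Max K"
    proof (intro iffI; elim conjE)
      assume k: "meets x y n k" and nx: "\<forall>i\<in>{1..Suc R}. \<not> meets x y n (k + i)"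
      have kK: "k \<in> K" using k by (simp add: K_def)
      have "k' \<le> k" if k': "k' \<in> K" for k'
      proof (rule ccontr)
        assume "\<not> k' \<le> k"
        hence "k' - k \<in> {1..Suc R}" "k + (k' - k) = k'" using win[OF kK k'] by auto
        thus False using nx k' by (force simp: K_def)
      qed
      hence "Max K = k" using kK K by (intro Max_eqI) auto
      thus "K \<noteq> {} \<and> k = Max K" using kK by auto
    next
      assume ne: "K \<noteq> {}" and k: "k = Max K"
      have "meets x y n k" using Max_in[OF K ne] k by (simp add: K_def)
      moreover have False if "i \<in> {1..Suc R}" "meets x y n (k + i)" for i
        using Max_ge[OF K, of "k + i"] that k by (simp add: K_def)
      ultimately show "meets x y n k \<and> (\<forall>i\<in>{1..Suc R}. \<not> meets x y n (k + i))" by blast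
    qed
    thus ?thesis using that by (simp add: last_meet_def)
  qed
  have "(\<Sum>k\<le>n. last_meet x y k (n - k)) = (\<Sum>k\<le>n. if K \<noteq> {} \<and> k = Max K then 1 else 0)"
    by (intro sum.cong) (auto simp: eq)
  also have "\<dots> = (if K \<noteq> {} then 1 else 0)"
  proof (cases "K = {}")
    case False
    have "Max K \<le> n" using Max_in[OF K False] by (simp add: K_def meets_def)
    then show ?thesis using False by simp
  qed simp
  finally show ?thesis using Kn by simp
qed

text \<open>The sum of r^n over n \<ge> d x y is r^(d x y) / (1 - r), but vectors truncated at M
  produce the square k, l \<le> M in place of the triangle k + l \<le> M. Since the terms are
  nonnegative, the square lies between the triangles for M and 2 * M.\<close>

lemma sum_last_meet_limit:
  assumes r: "0 < r" "r < (1::real)"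
  shows "(\<lambda>M. (1 - r) * (\<Sum>k\<le>M. \<Sum>l\<le>M. r ^ (k + l) * last_meet x y k l)) \<longlonglongrightarrow> r ^ d x y"
proof -
  define g where "g M = (\<Sum>n\<le>M. r ^ n * (if d x y \<le> n then 1 else 0))" for M
  have tri: "g M = (\<Sum>(k,l)\<in>{(k,l). k + l \<le> M}. r ^ (k + l) * last_meet x y k l)" for M
  proof -
    have "(\<Sum>(k,l)\<in>{(k,l). k + l \<le> M}. r ^ (k + l) * last_meet x y k l)
       = (\<Sum>n\<le>M. \<Sum>k\<le>n. r ^ (k + (n - k)) * last_meet x y k (n - k))"
      by (rule sum.triangle_reindex_eq)
    also have "\<dots> = (\<Sum>n\<le>M. r ^ n * (\<Sum>k\<le>n. last_meet x y k (n - k)))"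
      by (intro sum.cong refl) (simp add: sum_distrib_left)
    finally show ?thesis by (simp add: g_def sum_last_meet)
  qed
  have sq: "(\<Sum>k\<le>M. \<Sum>l\<le>M. r ^ (k + l) * last_meet x y k l) =
      (\<Sum>(k,l)\<in>{..M} \<times> {..M}. r ^ (k + l) * last_meet x y k l)" for M
    by (rule sum.cartesian_product)
  have nn: "0 \<le> r ^ (k + l) * last_meet x y k l" for k l
    using r by (simp add: last_meet_def)
  have fin: "finite {(k,l). k + l \<le> (M::nat)}" for M
    by (rule finite_subset[of _ "{..M} \<times> {..M}"]) auto
  have lo: "g M \<le> (\<Sum>k\<le>M. \<Sum>l\<le>M. r ^ (k + l) * last_meet x y k l)" for M
    unfolding tri sq by (rule sum_mono2) (use nn in auto)
  have hi: "(\<Sum>k\<le>M. \<Sum>l\<le>M. r ^ (k + l) * last_meet x y k l) \<le> g (2 * M)" for M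
    unfolding tri sq by (rule sum_mono2[OF fin]) (use nn in auto)
  have "(\<lambda>n. r ^ n * (if d x y \<le> n then 1 else 0)) sums (r ^ d x y / (1 - r))"
  proof -
    have "(\<lambda>n. r ^ d x y * r ^ n) sums (r ^ d x y * (1 / (1 - r)))"
      using r by (intro sums_mult geometric_sums) simp
    hence "(\<lambda>n. r ^ (n + d x y) * (if d x y \<le> n + d x y then 1 else 0)) sums (r ^ d x y / (1 - r))"
      by (simp add: power_add mult.commute)
    thus ?thesis by (subst (asm) sums_iff_shift) simp
  qed
  hence lim: "g \<longlonglongrightarrow> r ^ d x y / (1 - r)" by (simp add: sums_def_le g_def[abs_def])
  have "(\<lambda>M. \<Sum>k\<le>M. \<Sum>l\<le>M. r ^ (k + l) * last_meet x y k l) \<longlonglongrightarrow> r ^ d x y / (1 - r)"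
  proof (rule tendsto_sandwich[OF always_eventually always_eventually lim])
    show "(\<lambda>M. g (2 * M)) \<longlonglongrightarrow> r ^ d x y / (1 - r)"
      using LIMSEQ_subseq_LIMSEQ[OF lim, of "\<lambda>M. 2 * M"] by (simp add: strict_mono_def o_def)
  qed (use lo hi in auto)
  from tendsto_mult_left[OF this, of "1 - r"] show ?thesis using r by simp
qed

text \<open>Truncation at M and a finite set of subsets keep all sums finite, at the price of
  reaching the kernel only in the limit. The bounds depend on R and N alone: the 1 / (1 - r) of
  \<open>sum_window_squares\<close> is cancelled by the factor c in both families.\<close>

lemma ozawa_kernel:
  assumes r: "0 < r" "r < (1::real)" and X: "finite X"
  shows "\<exists>(\<Omega> :: nat \<Rightarrow> (nat \<times> ('a + nat)) set set) a b.
     (\<forall>M. finite (\<Omega> M)) \<and>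
     (\<forall>M. \<forall>x\<in>X. (\<Sum>\<omega>\<in>\<Omega> M. (a M x \<omega>)\<^sup>2) \<le> real ((R + 2) * 2 ^ ((R + 2) * (N + R + 2)))) \<and>
     (\<forall>M. \<forall>x\<in>X. (\<Sum>\<omega>\<in>\<Omega> M. (b M x \<omega>)\<^sup>2) \<le> real ((R + 2) * 2 ^ ((R + 2) * (N + R + 2)))) \<and>
     (\<forall>x\<in>X. \<forall>y\<in>X. (\<lambda>M. \<Sum>\<omega>\<in>\<Omega> M. a M x \<omega> * b M y \<omega>) \<longlonglongrightarrow> r ^ d x y)"
proof -
  define c where "c = sqrt (1 - r)"
  have c2: "c\<^sup>2 = 1 - r" "c * c = 1 - r" using r by (auto simp: c_def)
  \<comment> \<open>This covers the supports of all \<open>fwd_vec x k\<close> in question;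
    elsewhere every product vanishes.\<close>
  define \<Omega> where "\<Omega> M = (\<Union>x\<in>X. \<Union>k\<in>{..M}. Pow (fwd x k))" for M :: nat
  define a where "a M x \<omega> = c * (\<Sum>k\<le>M. r ^ k * fwd_vec x k \<omega>)" for M :: nat and x \<omega>
  define b where "b M x \<omega> = c * (\<Sum>k\<le>M. r ^ k * bwd_vec x k \<omega>)" for M :: nat and x \<omega>
  let ?K = "(R + 2) * (N + R + 2)"
  have fin: "finite (\<Omega> M)" for M using X finite_fwd by (auto simp: \<Omega>_def)
  have na: "(\<Sum>\<omega>\<in>\<Omega> M. (a M x \<omega>)\<^sup>2) \<le> real ((R + 2) * 2 ^ ?K)" for M x
  proof -
    have "(\<Sum>\<omega>\<in>\<Omega> M. (\<Sum>k\<le>M. r ^ k * fwd_vec x k \<omega>)\<^sup>2) \<le> real ((Suc R + 1) * 2 ^ ?K) / (1 - r)"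
    proof (rule sum_window_squares[where A = "fwd x"])
      show "\<bar>fwd_vec x k \<omega>\<bar> \<le> (if \<omega> \<subseteq> fwd x k \<and> \<omega> \<noteq> {} then 1 else 0)" for k \<omega>
        by (auto simp: fwd_vec_def)
      show "k' \<le> k + Suc R" if "fwd x k \<inter> fwd x k' \<noteq> {}" for k k'
        using that cells_near[of _ x "k + _" "k' + _"] by (fastforce simp: fwd_def)
    qed (use r fin finite_fwd card_fwd in auto)
    from mult_left_mono[OF this, of "1 - r"] show ?thesis
      using r by (simp add: a_def power_mult_distrib c2 sum_distrib_left[symmetric])
  qed
  have nb: "(\<Sum>\<omega>\<in>\<Omega> M. (b M x \<omega>)\<^sup>2) \<le> real ((R + 2) * 2 ^ ?K)" for M x
  proof -
    have "(\<Sum>\<omega>\<in>\<Omega> M. (\<Sum>k\<le>M. r ^ k * bwd_vec x k \<omega>)\<^sup>2) \<le> real ((Suc R + 1) * 2 ^ ?K) / (1 - r)"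
    proof (rule sum_window_squares[where A = "bwd x"])
      show "\<bar>bwd_vec x k \<omega>\<bar> \<le> (if \<omega> \<subseteq> bwd x k \<and> \<omega> \<noteq> {} then 1 else 0)" for k \<omega>
        by (auto simp: bwd_vec_def power_abs)
      show "k' \<le> k + Suc R" if ne: "bwd x k \<inter> bwd x k' \<noteq> {}" for k k'
      proof -
        obtain p where "p \<in> bwd x k" "p \<in> bwd x k'" using ne by blast
        then obtain i t where "i \<le> k" "i \<le> k'" "t \<in> cells x (k - i)" "t \<in> cells x (k' - i)"
          by (cases p) (auto simp: bwd_def)
        thus ?thesis using cells_near[of t x "k - i" "k' - i"] by linarith
      qed
    qed (use r fin finite_bwd card_bwd in auto)
    from mult_left_mono[OF this, of "1 - r"] show ?thesis
      using r by (simp add: b_def power_mult_distrib c2 sum_distrib_left[symmetric])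
  qed
  have ker: "(\<Sum>\<omega>\<in>\<Omega> M. a M x \<omega> * b M y \<omega>) = (1 - r) * (\<Sum>k\<le>M. \<Sum>l\<le>M. r ^ (k + l) * last_meet x y k l)"
    if "x \<in> X" for M x y
  proof -
    have "(\<Sum>\<omega>\<in>\<Omega> M. a M x \<omega> * b M y \<omega>)
       = (\<Sum>\<omega>\<in>\<Omega> M. (1 - r) * (\<Sum>k\<le>M. \<Sum>l\<le>M. r ^ (k + l) * (fwd_vec x k \<omega> * bwd_vec y l \<omega>)))"
    proof (rule sum.cong[OF refl])
      fix \<omega>
      have "a M x \<omega> * b M y \<omega> = (c * c) * ((\<Sum>k\<le>M. r ^ k * fwd_vec x k \<omega>) * (\<Sum>k\<le>M. r ^ k * bwd_vec y k \<omega>))"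
        by (simp add: a_def b_def)
      also have "\<dots> = (1 - r) * (\<Sum>k\<le>M. \<Sum>l\<le>M. r ^ (k + l) * (fwd_vec x k \<omega> * bwd_vec y l \<omega>))"
        unfolding sum_product c2 by (simp add: power_add mult_ac)
      finally show "a M x \<omega> * b M y \<omega> = \<dots>" .
    qed
    also have "\<dots> = (1 - r) * (\<Sum>k\<le>M. \<Sum>l\<le>M. r ^ (k + l) * (\<Sum>\<omega>\<in>\<Omega> M. fwd_vec x k \<omega> * bwd_vec y l \<omega>))"
      unfolding sum_distrib_left[symmetric]
      by (subst sum.swap, subst sum.swap) (simp add: sum_distrib_left)
    also have "\<dots> = (1 - r) * (\<Sum>k\<le>M. \<Sum>l\<le>M. r ^ (k + l) * last_meet x y k l)"
    proof (intro arg_cong2[where f = "(*)"] sum.cong refl)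
      fix k l assume "k \<in> {..M}" "l \<in> {..M}"
      hence "Pow (fwd x k) \<subseteq> \<Omega> M" using that by (auto simp: \<Omega>_def)
      from sum_fwd_bwd[OF fin this, of "k + l" y]
      show "(\<Sum>\<omega>\<in>\<Omega> M. fwd_vec x k \<omega> * bwd_vec y l \<omega>) = last_meet x y k l"
        by (simp add: last_meet_def)
    qed
    finally show ?thesis .
  qed
  show ?thesis
    by (rule exI[of _ \<Omega>], rule exI[of _ a], rule exI[of _ b])
       (use fin na nb sum_last_meet_limit[OF r] in \<open>simp add: ker\<close>)
qed

end

section \<open>Bounded operators and bilinear forms\<close>

lemma l2norm_nonneg: "0 \<le> l2norm \<xi>"
  by (simp add: l2norm_def infsum_nonneg)

lemma L2_set_le_l2norm:
  assumes "\<xi> \<in> l2" "finite H"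
  shows "L2_set (\<lambda>h. cmod (\<xi> h)) H \<le> l2norm \<xi>"
  unfolding L2_set_def l2norm_def
  using assms by (intro real_sqrt_le_mono finite_sum_le_infsum) (auto simp: l2_def)

lemma l2I:
  assumes "\<And>H. finite H \<Longrightarrow> L2_set (\<lambda>h. cmod (\<xi> h)) H \<le> c"
  shows "\<xi> \<in> l2" "l2norm \<xi> \<le> c"
proof -
  have c: "c \<ge> 0" using assms[of "{}"] by simp
  have le: "(\<Sum>h\<in>H. (cmod (\<xi> h))\<^sup>2) \<le> c\<^sup>2" if "finite H" for H
    using assms[OF that] c unfolding L2_set_def by (metis real_sqrt_le_iff real_sqrt_unique)
  have s: "(\<lambda>g. (cmod (\<xi> g))\<^sup>2) summable_on UNIV"
    by (rule nonneg_bdd_above_summable_on) (use le in \<open>auto intro!: bdd_aboveI[of _ "c\<^sup>2"]\<close>)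
  thus "\<xi> \<in> l2" by (simp add: l2_def)
  have "infsum (\<lambda>g. (cmod (\<xi> g))\<^sup>2) UNIV \<le> c\<^sup>2"
    by (rule infsum_le_finite_sums[OF s]) (use le in auto)
  hence "l2norm \<xi> \<le> sqrt (c\<^sup>2)" unfolding l2norm_def by (rule real_sqrt_le_mono)
  thus "l2norm \<xi> \<le> c" using c by simp
qed

lemma cmod_le_l2norm: "\<xi> \<in> l2 \<Longrightarrow> cmod (\<xi> h) \<le> l2norm \<xi>"
  using L2_set_le_l2norm[of \<xi> "{h}"] by simp

definition restr :: "'g set \<Rightarrow> ('g \<Rightarrow> complex) \<Rightarrow> 'g \<Rightarrow> complex" where
  "restr K \<xi> = (\<lambda>k. if k \<in> K then \<xi> k else 0)"

lemma restr_l2: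
  assumes "finite K"
  shows "restr K \<xi> \<in> l2" "l2norm (restr K \<xi>) \<le> L2_set (\<lambda>k. cmod (\<xi> k)) K"
proof -
  have *: "L2_set (\<lambda>h. cmod (restr K \<xi> h)) H \<le> L2_set (\<lambda>k. cmod (\<xi> k)) K" if "finite H" for H
  proof -
    have "(\<Sum>h\<in>H. (cmod (restr K \<xi> h))\<^sup>2) = (\<Sum>h\<in>H \<inter> K. (cmod (\<xi> h))\<^sup>2)"
      using that by (intro sum.mono_neutral_cong_right) (auto simp: restr_def)
    also have "\<dots> \<le> (\<Sum>h\<in>K. (cmod (\<xi> h))\<^sup>2)" using assms by (intro sum_mono2) auto
    finally show ?thesis by (simp add: L2_set_def)
  qed
  show "restr K \<xi> \<in> l2" "l2norm (restr K \<xi>) \<le> L2_set (\<lambda>k. cmod (\<xi> k)) K"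
    using l2I[OF *] by auto
qed

lemma delta_e_l2: "(delta_e :: 'g::group_add \<Rightarrow> complex) \<in> l2"
    "l2norm (delta_e :: 'g \<Rightarrow> complex) = 1"
proof -
  let ?\<delta> = "delta_e :: 'g \<Rightarrow> complex"
  have eq: "?\<delta> = restr {0} (\<lambda>_. 1)" by (auto simp: delta_e_def restr_def)
  show l2: "?\<delta> \<in> l2" unfolding eq by (rule restr_l2) simp
  hence "1 \<le> l2norm ?\<delta>" using cmod_le_l2norm[of ?\<delta> 0] by (simp add: delta_e_def)
  moreover have "l2norm ?\<delta> \<le> 1" unfolding eq using restr_l2(2)[of "{0::'g}" "\<lambda>_. 1"] by simp
  ultimately show "l2norm ?\<delta> = 1" by simp
qed

lemma opbound_nonneg:
  assumes "opbound (T :: ('g::group_add \<Rightarrow> complex) \<Rightarrow> 'g \<Rightarrow> complex) c"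
  shows "0 \<le> c"
  using assms delta_e_l2 l2norm_nonneg[of "T delta_e"] unfolding opbound_def
  by (metis mult.right_neutral order_trans)

lemma opboundI:
  assumes "\<And>\<xi> H. \<xi> \<in> l2 \<Longrightarrow> finite H \<Longrightarrow> L2_set (\<lambda>h. cmod (T \<xi> h)) H \<le> c * l2norm \<xi>"
  shows "opbound T c"
  unfolding opbound_def using l2I[OF assms] by blast

lemma opbound_L2_set:
  assumes "opbound T c" "\<xi> \<in> l2" "finite H"
  shows "L2_set (\<lambda>h. cmod (T \<xi> h)) H \<le> c * l2norm \<xi>"
  using assms L2_set_le_l2norm[of "T \<xi>" H] unfolding opbound_def by (meson order_trans)

lemma opbound_cmod:
  assumes "opbound T c" "\<xi> \<in> l2"
  shows "cmod (T \<xi> h) \<le> c * l2norm \<xi>"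
  using opbound_L2_set[OF assms, of "{h}"] by simp

lemma opbound_mono: "opbound T a \<Longrightarrow> a \<le> b \<Longrightarrow> opbound T b"
  unfolding opbound_def by (meson l2norm_nonneg mult_right_mono order_trans)

lemma opbound_add:
  assumes "opbound S a" "opbound T b"
  shows "opbound (\<lambda>\<xi> h. S \<xi> h + T \<xi> h) (a + b)"
proof (rule opboundI)
  fix \<xi> :: "'a \<Rightarrow> complex" and H :: "'a set" assume \<xi>: "\<xi> \<in> l2" and H: "finite H"
  have "L2_set (\<lambda>h. cmod (S \<xi> h + T \<xi> h)) H \<le> L2_set (\<lambda>h. cmod (S \<xi> h) + cmod (T \<xi> h)) H"
    by (intro L2_set_mono norm_triangle_ineq) auto
  also have "\<dots> \<le> L2_set (\<lambda>h. cmod (S \<xi> h)) H + L2_set (\<lambda>h. cmod (T \<xi> h)) H"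
    by (rule L2_set_triangle_ineq)
  also have "\<dots> \<le> (a + b) * l2norm \<xi>"
    using opbound_L2_set[OF assms(1) \<xi> H] opbound_L2_set[OF assms(2) \<xi> H] by (simp add: algebra_simps)
  finally show "L2_set (\<lambda>h. cmod (S \<xi> h + T \<xi> h)) H \<le> (a + b) * l2norm \<xi>" .
qed

lemma opbound_scale:
  assumes "opbound T a"
  shows "opbound (\<lambda>\<xi> h. c * T \<xi> h) (cmod c * a)"
proof (rule opboundI)
  fix \<xi> :: "'a \<Rightarrow> complex" and H :: "'a set" assume \<xi>: "\<xi> \<in> l2" and H: "finite H"
  have "L2_set (\<lambda>h. cmod (c * T \<xi> h)) H = cmod c * L2_set (\<lambda>h. cmod (T \<xi> h)) H"
    by (simp add: norm_mult L2_set_right_distrib)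
  also have "\<dots> \<le> cmod c * (a * l2norm \<xi>)"
    using opbound_L2_set[OF assms \<xi> H] by (rule mult_left_mono) simp
  finally show "L2_set (\<lambda>h. cmod (c * T \<xi> h)) H \<le> cmod c * a * l2norm \<xi>" by (simp add: mult.assoc)
qed

lemma opbound_diff:
  assumes "opbound S a" "opbound T b"
  shows "opbound (\<lambda>\<xi> h. S \<xi> h - T \<xi> h) (a + b)"
  using opbound_add[OF assms(1) opbound_scale[OF assms(2), of "-1"]] by simp

lemma opbound_sum:
  assumes "finite F" "\<And>g. g \<in> F \<Longrightarrow> opbound (T g) (a g)"
  shows "opbound (\<lambda>\<xi> h. \<Sum>g\<in>F. T g \<xi> h) (\<Sum>g\<in>F. a g)"
  using assms
proof (induction F)
  case empty
  show ?case by (rule opboundI) (simp add: L2_set_def)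
next
  case (insert g F)
  have "opbound (\<lambda>\<xi> h. T g \<xi> h + (\<Sum>g\<in>F. T g \<xi> h)) (a g + (\<Sum>g\<in>F. a g))"
    using insert by (intro opbound_add) auto
  then show ?case using insert by simp
qed

text \<open>\<open>opboundI\<close> tests finitely many coordinates at a time, so pointwise
  convergence is enough.\<close>

lemma opbound_limit:
  assumes lim: "\<And>\<xi> h. \<xi> \<in> l2 \<Longrightarrow> ((\<lambda>n. T n \<xi> h) \<longlongrightarrow> T' \<xi> h) F" and F: "F \<noteq> bot"
    and ev: "eventually (\<lambda>n. opbound (T n) c) F"
  shows "opbound T' c"
proof (rule opboundI)
  fix \<xi> :: "'a \<Rightarrow> complex" and H :: "'a set" assume \<xi>: "\<xi> \<in> l2" and H: "finite H"
  have "((\<lambda>n. L2_set (\<lambda>h. cmod (T n \<xi> h)) H) \<longlongrightarrow> L2_set (\<lambda>h. cmod (T' \<xi> h)) H) F"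
    unfolding L2_set_def using lim[OF \<xi>] by (intro tendsto_intros)
  moreover have "eventually (\<lambda>n. L2_set (\<lambda>h. cmod (T n \<xi> h)) H \<le> c * l2norm \<xi>) F"
    using ev by eventually_elim (rule opbound_L2_set[OF _ \<xi> H])
  ultimately show "L2_set (\<lambda>h. cmod (T' \<xi> h)) H \<le> c * l2norm \<xi>"
    using F by (rule tendsto_upperbound)
qed

section \<open>Bilinear forms and Schur multipliers\<close>

text \<open>The operator norm of a matrix, tested on finitely supported vectors. In this form
  entrywise multiplication becomes a statement about finite sums.\<close>

definition bform :: "('h \<Rightarrow> 'k \<Rightarrow> complex) \<Rightarrow> real \<Rightarrow> bool" where
  "bform X c \<longleftrightarrow> (\<forall>H K \<xi> \<zeta>. finite H \<longrightarrow> finite K \<longrightarrow>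
     cmod (\<Sum>h\<in>H. \<Sum>k\<in>K. X h k * \<xi> k * \<zeta> h) \<le> c * L2_set (\<lambda>k. cmod (\<xi> k)) K * L2_set (\<lambda>h. cmod (\<zeta> h)) H)"

lemma bformD: "bform X c \<Longrightarrow> finite H \<Longrightarrow> finite K \<Longrightarrow>
     cmod (\<Sum>h\<in>H. \<Sum>k\<in>K. X h k * \<xi> k * \<zeta> h) \<le> c * L2_set (\<lambda>k. cmod (\<xi> k)) K * L2_set (\<lambda>h. cmod (\<zeta> h)) H"
  by (simp add: bform_def)

lemma bform_add:
  assumes "bform X a" "bform Y b"
  shows "bform (\<lambda>h k. X h k + Y h k) (a + b)"
  unfolding bform_def
proof (intro allI impI)
  fix H :: "'a set" and K :: "'b set" and \<xi> \<zeta> assume HK: "finite H" "finite K"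
  have "(\<Sum>h\<in>H. \<Sum>k\<in>K. (X h k + Y h k) * \<xi> k * \<zeta> h)
     = (\<Sum>h\<in>H. \<Sum>k\<in>K. X h k * \<xi> k * \<zeta> h) + (\<Sum>h\<in>H. \<Sum>k\<in>K. Y h k * \<xi> k * \<zeta> h)"
    by (simp add: algebra_simps sum.distrib)
  also have "cmod \<dots> \<le> cmod (\<Sum>h\<in>H. \<Sum>k\<in>K. X h k * \<xi> k * \<zeta> h) + cmod (\<Sum>h\<in>H. \<Sum>k\<in>K. Y h k * \<xi> k * \<zeta> h)"
    by (rule norm_triangle_ineq)
  also have "\<dots> \<le> (a + b) * L2_set (\<lambda>k. cmod (\<xi> k)) K * L2_set (\<lambda>h. cmod (\<zeta> h)) H"
    using bformD[OF assms(1) HK, of \<xi> \<zeta>] bformD[OF assms(2) HK, of \<xi> \<zeta>] by (simp add: algebra_simps)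
  finally show "cmod (\<Sum>h\<in>H. \<Sum>k\<in>K. (X h k + Y h k) * \<xi> k * \<zeta> h) \<le> \<dots>" .
qed

lemma bform_sum:
  assumes "finite I" "\<And>i. i \<in> I \<Longrightarrow> bform (X i) (a i)"
  shows "bform (\<lambda>h k. \<Sum>i\<in>I. X i h k) (\<Sum>i\<in>I. a i)"
  using assms
proof (induction I)
  case empty
  show ?case by (simp add: bform_def)
next
  case (insert i I)
  then show ?case using bform_add[of "X i" "a i" "\<lambda>h k. \<Sum>i\<in>I. X i h k"] by simp
qed

lemma bform_mono: "bform X a \<Longrightarrow> a \<le> b \<Longrightarrow> bform X b"
  unfolding bform_def
  by (meson L2_set_nonneg mult_right_mono order_trans)

lemma norm_sum_mult_le_L2_set:
  "cmod (\<Sum>h\<in>H. u h * v h) \<le> L2_set (\<lambda>h. cmod (u h)) H * L2_set (\<lambda>h. cmod (v h)) H"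
proof -
  have "cmod (\<Sum>h\<in>H. u h * v h) \<le> (\<Sum>h\<in>H. \<bar>cmod (u h)\<bar> * \<bar>cmod (v h)\<bar>)"
    by (rule order_trans[OF norm_sum]) (simp add: norm_mult)
  also have "\<dots> \<le> L2_set (\<lambda>h. cmod (u h)) H * L2_set (\<lambda>h. cmod (v h)) H"
    by (rule L2_set_mult_ineq)
  finally show ?thesis .
qed

text \<open>The easy half of Grothendieck's description of Schur multipliers: each i contributes the
  form X at the vectors \<xi> and \<zeta> weighted by b and a, and Cauchy-Schwarz over i yields a
  factor sqrt A from each side.\<close>

lemma schur_multiplier_bound:
  fixes a :: "'h \<Rightarrow> 'i \<Rightarrow> real" and b :: "'k \<Rightarrow> 'i \<Rightarrow> real"
  assumes X: "bform X c" and c: "c \<ge> 0" and HK: "finite H" "finite K"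
    and a: "\<And>h. h \<in> H \<Longrightarrow> (\<Sum>i\<in>I. (a h i)\<^sup>2) \<le> A" and b: "\<And>k. k \<in> K \<Longrightarrow> (\<Sum>i\<in>I. (b k i)\<^sup>2) \<le> A"
    and A: "A \<ge> 0"
  shows "cmod (\<Sum>h\<in>H. \<Sum>k\<in>K. X h k * of_real (\<Sum>i\<in>I. a h i * b k i) * \<xi> k * \<zeta> h)
    \<le> A * c * L2_set (\<lambda>k. cmod (\<xi> k)) K * L2_set (\<lambda>h. cmod (\<zeta> h)) H"
proof -
  define p where "p i = L2_set (\<lambda>k. cmod (\<xi> k * of_real (b k i))) K" for i
  define q where "q i = L2_set (\<lambda>h. cmod (\<zeta> h * of_real (a h i))) H" for i
  have weighted: "L2_set (\<lambda>i. L2_set (\<lambda>k. cmod (\<theta> k * of_real (e k i))) K') I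
      \<le> sqrt A * L2_set (\<lambda>k. cmod (\<theta> k)) K'"
    if "\<And>k. k \<in> K' \<Longrightarrow> (\<Sum>i\<in>I. (e k i)\<^sup>2) \<le> A" for \<theta> :: "'x \<Rightarrow> complex" and e K'
  proof -
    have "(\<Sum>i\<in>I. (L2_set (\<lambda>k. cmod (\<theta> k * of_real (e k i))) K')\<^sup>2)
        = (\<Sum>i\<in>I. \<Sum>k\<in>K'. (cmod (\<theta> k))\<^sup>2 * (e k i)\<^sup>2)"
      by (simp add: L2_set_def sum_nonneg norm_mult power_mult_distrib)
    also have "\<dots> = (\<Sum>k\<in>K'. (cmod (\<theta> k))\<^sup>2 * (\<Sum>i\<in>I. (e k i)\<^sup>2))"
      by (subst sum.swap) (simp add: sum_distrib_left)
    also have "\<dots> \<le> (\<Sum>k\<in>K'. (cmod (\<theta> k))\<^sup>2 * A)"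
      using that by (intro sum_mono mult_left_mono) auto
    also have "\<dots> = A * (\<Sum>k\<in>K'. (cmod (\<theta> k))\<^sup>2)" by (simp add: sum_distrib_left mult.commute)
    finally have "sqrt (\<Sum>i\<in>I. (L2_set (\<lambda>k. cmod (\<theta> k * of_real (e k i))) K')\<^sup>2)
        \<le> sqrt (A * (\<Sum>k\<in>K'. (cmod (\<theta> k))\<^sup>2))" by (rule real_sqrt_le_mono)
    thus ?thesis by (simp add: L2_set_def[of _ I] L2_set_def[of "\<lambda>k. cmod (\<theta> k)"] real_sqrt_mult)
  qed
  have "(\<Sum>h\<in>H. \<Sum>k\<in>K. X h k * of_real (\<Sum>i\<in>I. a h i * b k i) * \<xi> k * \<zeta> h)
     = (\<Sum>h\<in>H. \<Sum>k\<in>K. \<Sum>i\<in>I. X h k * (\<xi> k * of_real (b k i)) * (\<zeta> h * of_real (a h i)))"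
    by (simp add: sum_distrib_left sum_distrib_right mult_ac)
  also have "\<dots> = (\<Sum>h\<in>H. \<Sum>i\<in>I. \<Sum>k\<in>K. X h k * (\<xi> k * of_real (b k i)) * (\<zeta> h * of_real (a h i)))"
    by (intro sum.cong refl sum.swap)
  also have "\<dots> = (\<Sum>i\<in>I. \<Sum>h\<in>H. \<Sum>k\<in>K. X h k * (\<xi> k * of_real (b k i)) * (\<zeta> h * of_real (a h i)))"
    by (rule sum.swap)
  also have "cmod \<dots> \<le> (\<Sum>i\<in>I. c * p i * q i)"
    unfolding p_def q_def by (intro sum_norm_le bformD[OF X HK])
  also have "\<dots> = c * (\<Sum>i\<in>I. \<bar>p i\<bar> * \<bar>q i\<bar>)"
    by (simp add: sum_distrib_left mult.assoc p_def q_def)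
  also have "\<dots> \<le> c * (L2_set p I * L2_set q I)"
    using c by (intro mult_left_mono L2_set_mult_ineq) auto
  also have "\<dots> \<le> c * ((sqrt A * L2_set (\<lambda>k. cmod (\<xi> k)) K) * (sqrt A * L2_set (\<lambda>h. cmod (\<zeta> h)) H))"
    unfolding p_def q_def using c a b A
    by (intro mult_left_mono mult_mono weighted) auto
  also have "\<dots> = (sqrt A * sqrt A) * c * L2_set (\<lambda>k. cmod (\<xi> k)) K * L2_set (\<lambda>h. cmod (\<zeta> h)) H"
    by (simp add: mult_ac)
  also have "sqrt A * sqrt A = A" using A by simp
  finally show ?thesis .
qed

section \<open>Twisted convolution operators\<close>

definition coeff_matrix :: "('g::group_add \<Rightarrow> 'g \<Rightarrow> complex) \<Rightarrow> ('g \<Rightarrow> complex) \<Rightarrow> 'g \<Rightarrow> 'g \<Rightarrow> complex" where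
  "coeff_matrix \<sigma> f h k = f (h - k) * \<sigma> (h - k) k"

abbreviation psum :: "('g::group_add \<Rightarrow> 'g \<Rightarrow> complex) \<Rightarrow> 'g set \<Rightarrow> ('g \<Rightarrow> complex) \<Rightarrow> ('g \<Rightarrow> complex) \<Rightarrow> 'g \<Rightarrow> complex" where
  "psum \<sigma> F f \<xi> h \<equiv> \<Sum>g\<in>F. f g * Lambda \<sigma> g \<xi> h"

text \<open>\<open>T\<close> is an arbitrary function, with no linearity built in. The first clause
  determines it on finitely supported vectors; the second, continuity along truncations, carries
  estimates over to all of \<open>l2\<close>.\<close>

definition has_matrix :: "('g::group_add \<Rightarrow> 'g \<Rightarrow> complex) \<Rightarrow> (('g \<Rightarrow> complex) \<Rightarrow> 'g \<Rightarrow> complex) \<Rightarrow> ('g \<Rightarrow> complex) \<Rightarrow> bool" where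
  "has_matrix \<sigma> T f \<longleftrightarrow>
     (\<forall>K \<xi> h. finite K \<longrightarrow> T (restr K \<xi>) h = (\<Sum>k\<in>K. coeff_matrix \<sigma> f h k * \<xi> k)) \<and>
     (\<forall>\<xi>\<in>l2. \<forall>h. ((\<lambda>K. T (restr K \<xi>) h) \<longlongrightarrow> T \<xi> h) (finite_subsets_at_top UNIV))"

lemma nonpos_if_le_small_multiple:
  fixes a B :: real
  assumes "\<And>\<epsilon>. \<epsilon> > 0 \<Longrightarrow> a \<le> \<epsilon> * B" "B \<ge> 0"
  shows "a \<le> 0"
proof (rule ccontr)
  assume a: "\<not> a \<le> 0"
  have "a \<le> (a / (B + 1)) * B" using assms a by (intro assms(1)) auto
  hence "a * (B + 1) \<le> a * B" using assms(2) by (simp add: field_simps)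
  thus False using a by (simp add: algebra_simps)
qed

lemma has_matrix_diff:
  assumes "has_matrix \<sigma> S f" "has_matrix \<sigma> T g"
  shows "has_matrix \<sigma> (\<lambda>\<xi> h. S \<xi> h - T \<xi> h) (\<lambda>k. f k - g k)"
proof -
  have "coeff_matrix \<sigma> (\<lambda>k. f k - g k) h k = coeff_matrix \<sigma> f h k - coeff_matrix \<sigma> g h k" for h k
    by (simp add: coeff_matrix_def left_diff_distrib)
  hence "(\<Sum>k\<in>K. coeff_matrix \<sigma> (\<lambda>k. f k - g k) h k * \<xi> k) = (\<Sum>k\<in>K. coeff_matrix \<sigma> f h k * \<xi> k) - (\<Sum>k\<in>K. coeff_matrix \<sigma> g h k * \<xi> k)" for K h \<xi>
    by (simp add: left_diff_distrib sum_subtractf)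
  thus ?thesis using assms unfolding has_matrix_def by (simp add: tendsto_diff)
qed

lemma psum_restr:
  assumes "finite F" "finite K"
  shows "psum \<sigma> F f (restr K \<xi>) h = (\<Sum>k\<in>K. coeff_matrix \<sigma> (\<lambda>g. if g \<in> F then f g else 0) h k * \<xi> k)"
proof -
  have inv: "h - (- g + h) = g" "- (h - k) + h = k" for g k :: 'a
    by (simp_all add: diff_conv_add_uminus minus_add add.assoc del: add_uminus_conv_diff)
  have "psum \<sigma> F f (restr K \<xi>) h = (\<Sum>g\<in>{g\<in>F. - g + h \<in> K}. f g * (\<sigma> g (- g + h) * \<xi> (- g + h)))"
    using assms by (intro sum.mono_neutral_cong_right) (auto simp: Lambda_def restr_def)
  also have "\<dots> = (\<Sum>k\<in>{k\<in>K. h - k \<in> F}. f (h - k) * (\<sigma> (h - k) k * \<xi> k))"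
    by (rule sum.reindex_bij_witness[where i = "\<lambda>k. h - k" and j = "\<lambda>g. - g + h"]) (auto simp: inv)
  also have "\<dots> = (\<Sum>k\<in>K. coeff_matrix \<sigma> (\<lambda>g. if g \<in> F then f g else 0) h k * \<xi> k)"
    using assms by (intro sum.mono_neutral_cong_left) (auto simp: coeff_matrix_def)
  finally show ?thesis .
qed

lemma has_matrix_psum:
  assumes "finite F"
  shows "has_matrix \<sigma> (psum \<sigma> F f) (\<lambda>g. if g \<in> F then f g else 0)"
  unfolding has_matrix_def
proof (intro conjI allI impI ballI)
  fix K :: "'a set" and \<xi> h assume "finite K"
  thus "psum \<sigma> F f (restr K \<xi>) h = (\<Sum>k\<in>K. coeff_matrix \<sigma> (\<lambda>g. if g \<in> F then f g else 0) h k * \<xi> k)"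
    using assms by (rule psum_restr[rotated])
next
  fix \<xi> :: "'a \<Rightarrow> complex" and h
  have "eventually (\<lambda>K. psum \<sigma> F f (restr K \<xi>) h = psum \<sigma> F f \<xi> h) (finite_subsets_at_top UNIV)"
    unfolding eventually_finite_subsets_at_top
    by (rule exI[of _ "(\<lambda>g. - g + h) ` F"]) (use assms in \<open>auto simp: Lambda_def restr_def intro!: sum.cong\<close>)
  thus "((\<lambda>K. psum \<sigma> F f (restr K \<xi>) h) \<longlongrightarrow> psum \<sigma> F f \<xi> h) (finite_subsets_at_top UNIV)"
    by (rule tendsto_eventually)
qed

lemma bform_if_opbound:
  assumes T: "has_matrix \<sigma> T f" and c: "opbound T c"
  shows "bform (coeff_matrix \<sigma> f) c"
  unfolding bform_def
proof (intro allI impI)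
  fix H K :: "'a set" and \<xi> \<zeta> assume HK: "finite H" "finite K"
  have c0: "c \<ge> 0" using opbound_nonneg[OF c] .
  have "(\<Sum>h\<in>H. \<Sum>k\<in>K. coeff_matrix \<sigma> f h k * \<xi> k * \<zeta> h) = (\<Sum>h\<in>H. T (restr K \<xi>) h * \<zeta> h)"
    using T HK by (simp add: has_matrix_def sum_distrib_right)
  also have "cmod \<dots> \<le> L2_set (\<lambda>h. cmod (T (restr K \<xi>) h)) H * L2_set (\<lambda>h. cmod (\<zeta> h)) H"
    by (rule norm_sum_mult_le_L2_set)
  also have "\<dots> \<le> (c * L2_set (\<lambda>k. cmod (\<xi> k)) K) * L2_set (\<lambda>h. cmod (\<zeta> h)) H"
    using opbound_L2_set[OF c restr_l2(1)[OF HK(2)] HK(1), of \<xi>] mult_left_mono[OF restr_l2(2)[OF HK(2), of \<xi>] c0]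
    by (intro mult_right_mono) auto
  finally show "cmod (\<Sum>h\<in>H. \<Sum>k\<in>K. coeff_matrix \<sigma> f h k * \<xi> k * \<zeta> h)
      \<le> c * L2_set (\<lambda>k. cmod (\<xi> k)) K * L2_set (\<lambda>h. cmod (\<zeta> h)) H" .
qed

text \<open>For a truncated vector the form is tested at the conjugate of its image, which gives l *
  l \<le> c * l2norm \<xi> * l; the general case follows by letting the truncation grow.\<close>

lemma opbound_if_bform:
  assumes T: "has_matrix \<sigma> T f" and X: "bform (coeff_matrix \<sigma> f) c" and c: "c \<ge> 0"
  shows "opbound T c"
proof (rule opbound_limit)
  show "finite_subsets_at_top (UNIV :: 'a set) \<noteq> bot" by simp
  show "((\<lambda>K. T (restr K \<xi>) h) \<longlongrightarrow> T \<xi> h) (finite_subsets_at_top UNIV)" if "\<xi> \<in> l2" for \<xi> h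
    using T that by (simp add: has_matrix_def)
  have "opbound (\<lambda>\<xi>. T (restr K \<xi>)) c" if K: "finite K" for K
  proof (rule opboundI)
    fix \<xi> :: "'a \<Rightarrow> complex" and H :: "'a set" assume \<xi>: "\<xi> \<in> l2" and H: "finite H"
    define t where "t = T (restr K \<xi>)"
    define l where "l = L2_set (\<lambda>h. cmod (t h)) H"
    have "complex_of_real (l\<^sup>2) = (\<Sum>h\<in>H. t h * cnj (t h))"
      by (simp add: l_def L2_set_def sum_nonneg complex_norm_square[symmetric])
    also have "\<dots> = (\<Sum>h\<in>H. \<Sum>k\<in>K. coeff_matrix \<sigma> f h k * \<xi> k * cnj (t h))"
      using T K by (simp add: has_matrix_def sum_distrib_right t_def)
    finally have "l\<^sup>2 = cmod (\<Sum>h\<in>H. \<Sum>k\<in>K. coeff_matrix \<sigma> f h k * \<xi> k * cnj (t h))"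
      by (metis norm_of_real abs_power2)
    also have "\<dots> \<le> c * L2_set (\<lambda>k. cmod (\<xi> k)) K * l"
      using bformD[OF X H K, of \<xi> "\<lambda>h. cnj (t h)"] by (simp add: l_def)
    also have "\<dots> \<le> c * l2norm \<xi> * l"
      using c L2_set_le_l2norm[OF \<xi> K] by (intro mult_right_mono mult_left_mono) (auto simp: l_def)
    finally have "l * l \<le> c * l2norm \<xi> * l" by (simp add: power2_eq_square)
    moreover have "l \<ge> 0" "c * l2norm \<xi> \<ge> 0" using c l2norm_nonneg[of \<xi>] by (auto simp: l_def)
    ultimately have "l \<le> c * l2norm \<xi>" by (cases "l = 0") auto
    thus "L2_set (\<lambda>h. cmod (T (restr K \<xi>) h)) H \<le> c * l2norm \<xi>" by (simp add: l_def t_def)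
  qed
  thus "\<forall>\<^sub>F K in finite_subsets_at_top UNIV. opbound (\<lambda>\<xi>. T (restr K \<xi>)) c"
    unfolding eventually_finite_subsets_at_top by blast
qed

section \<open>Matrices of elements of the reduced twisted group algebra\<close>

locale twisted_group =
  fixes \<sigma> :: "'g::group_add \<Rightarrow> 'g \<Rightarrow> complex"
  assumes norm_\<sigma> [simp]: "cmod (\<sigma> g h) = 1" and \<sigma>_0 [simp]: "\<sigma> g 0 = 1"
begin

lemma opbound_Lambda: "opbound (Lambda \<sigma> g) 1"
proof (rule opboundI)
  fix \<xi> :: "'g \<Rightarrow> complex" and H :: "'g set" assume \<xi>: "\<xi> \<in> l2" and H: "finite H"
  have "L2_set (\<lambda>h. cmod (Lambda \<sigma> g \<xi> h)) H = L2_set (\<lambda>k. cmod (\<xi> k)) ((\<lambda>h. - g + h) ` H)"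
    unfolding L2_set_def by (subst sum.reindex) (auto simp: Lambda_def norm_mult inj_on_def)
  also have "\<dots> \<le> l2norm \<xi>" using L2_set_le_l2norm[OF \<xi>] H by simp
  finally show "L2_set (\<lambda>h. cmod (Lambda \<sigma> g \<xi> h)) H \<le> 1 * l2norm \<xi>" by simp
qed

lemma opbound_psum:
  assumes "finite F"
  shows "opbound (psum \<sigma> F f) (\<Sum>g\<in>F. cmod (f g))"
  using opbound_sum[OF assms opbound_scale[OF opbound_Lambda], of f "\<lambda>g. g"] by simp

text \<open>Normalization of \<sigma> enters here: \<open>\<sigma> g 0 = 1\<close> makes
  \<open>Lambda \<sigma> g\<close> send \<open>delta_e\<close> to the unit vector at g.\<close>

lemma psum_delta:
  assumes "finite F"
  shows "psum \<sigma> F f delta_e g = (if g \<in> F then f g else 0)"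
proof -
  have "- g' + g = 0 \<longleftrightarrow> g' = g" for g' :: 'g
    by (metis add.right_neutral add_minus_cancel left_minus)
  hence "psum \<sigma> F f delta_e g = (\<Sum>g'\<in>F. if g' = g then f g' else 0)"
    by (intro sum.cong) (auto simp: Lambda_def delta_e_def)
  thus ?thesis using assms by simp
qed

lemma fourier_coeff_approx:
  assumes "finite F" "opbound (\<lambda>\<xi> h. x \<xi> h - psum \<sigma> F c \<xi> h) \<epsilon>"
  shows "cmod (fourier_coeff x g - (if g \<in> F then c g else 0)) \<le> \<epsilon>"
  using opbound_cmod[OF assms(2) delta_e_l2(1), of g]
  by (simp add: fourier_coeff_def psum_delta[OF assms(1)] delta_e_l2(2))

text \<open>Even linearity of x on \<open>l2\<close> has to be read off from its approximations.
  Both clauses hold for finite sums, and replacing x by such a sum costs at most \<epsilon> times a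
  quantity fixed beforehand.\<close>

lemma has_matrix_reduced_cstar:
  assumes x: "x \<in> reduced_cstar \<sigma>"
  shows "has_matrix \<sigma> x (fourier_coeff x)"
  unfolding has_matrix_def
proof (intro conjI allI impI ballI)
  fix K :: "'g set" and \<xi> h assume K: "finite K"
  define B where "B = l2norm (restr K \<xi>) + (\<Sum>k\<in>K. cmod (\<xi> k))"
  have "cmod (x (restr K \<xi>) h - (\<Sum>k\<in>K. coeff_matrix \<sigma> (fourier_coeff x) h k * \<xi> k)) \<le> 0"
  proof (rule nonpos_if_le_small_multiple)
    show "B \<ge> 0" by (simp add: B_def l2norm_nonneg sum_nonneg)
    fix \<epsilon> :: real assume "\<epsilon> > 0"
    then obtain F c where F: "finite F" and Fc: "opbound (\<lambda>\<xi> h. x \<xi> h - psum \<sigma> F c \<xi> h) \<epsilon>"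
      using x unfolding reduced_cstar_def by blast
    let ?c = "\<lambda>g. if g \<in> F then c g else 0"
    have eq: "x (restr K \<xi>) h - (\<Sum>k\<in>K. coeff_matrix \<sigma> (fourier_coeff x) h k * \<xi> k)
      = (x (restr K \<xi>) h - psum \<sigma> F c (restr K \<xi>) h)
        - (\<Sum>k\<in>K. (fourier_coeff x (h - k) - ?c (h - k)) * \<sigma> (h - k) k * \<xi> k)"
      unfolding psum_restr[OF F K] by (simp add: coeff_matrix_def sum_subtractf left_diff_distrib)
    have "cmod (x (restr K \<xi>) h - (\<Sum>k\<in>K. coeff_matrix \<sigma> (fourier_coeff x) h k * \<xi> k))
      \<le> cmod (x (restr K \<xi>) h - psum \<sigma> F c (restr K \<xi>) h)
        + cmod (\<Sum>k\<in>K. (fourier_coeff x (h - k) - ?c (h - k)) * \<sigma> (h - k) k * \<xi> k)"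
      unfolding eq by (rule norm_triangle_ineq4)
    also have "\<dots> \<le> \<epsilon> * l2norm (restr K \<xi>) + (\<Sum>k\<in>K. \<epsilon> * cmod (\<xi> k))"
    proof (rule add_mono)
      show "cmod (x (restr K \<xi>) h - psum \<sigma> F c (restr K \<xi>) h) \<le> \<epsilon> * l2norm (restr K \<xi>)"
        using opbound_cmod[OF Fc restr_l2(1)[OF K, of \<xi>], of h] .
      have "cmod ((fourier_coeff x (h - k) - ?c (h - k)) * \<sigma> (h - k) k * \<xi> k) \<le> \<epsilon> * cmod (\<xi> k)" for k
      proof -
        have "cmod (fourier_coeff x (h - k) - ?c (h - k)) * cmod (\<xi> k) \<le> \<epsilon> * cmod (\<xi> k)"
          by (rule mult_right_mono[OF fourier_coeff_approx[OF F Fc] norm_ge_zero])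
        thus ?thesis by (simp only: norm_mult norm_\<sigma> mult_1_right)
      qed
      thus "cmod (\<Sum>k\<in>K. (fourier_coeff x (h - k) - ?c (h - k)) * \<sigma> (h - k) k * \<xi> k) \<le> (\<Sum>k\<in>K. \<epsilon> * cmod (\<xi> k))"
        by (rule sum_norm_le)
    qed
    finally show "cmod (x (restr K \<xi>) h - (\<Sum>k\<in>K. coeff_matrix \<sigma> (fourier_coeff x) h k * \<xi> k)) \<le> \<epsilon> * B"
      by (simp add: B_def distrib_left sum_distrib_left)
  qed
  thus "x (restr K \<xi>) h = (\<Sum>k\<in>K. coeff_matrix \<sigma> (fourier_coeff x) h k * \<xi> k)" by simp
next
  fix \<xi> :: "'g \<Rightarrow> complex" and h assume \<xi>: "\<xi> \<in> l2"
  show "((\<lambda>K. x (restr K \<xi>) h) \<longlongrightarrow> x \<xi> h) (finite_subsets_at_top UNIV)"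
  proof (rule tendstoI)
    fix e :: real assume e: "e > 0"
    \<comment> \<open>The factor 2 pays for the errors at \<xi> and at its truncation; the 1 guards
      against \<open>l2norm \<xi> = 0\<close>.\<close>
    define \<epsilon> where "\<epsilon> = e / (2 * l2norm \<xi> + 1)"
    have ep: "\<epsilon> > 0" and e2: "2 * \<epsilon> * l2norm \<xi> < e"
    proof -
      show ep: "\<epsilon> > 0" using e l2norm_nonneg[of \<xi>] by (simp add: \<epsilon>_def)
      have "\<epsilon> * (2 * l2norm \<xi> + 1) = e" using l2norm_nonneg[of \<xi>] by (simp add: \<epsilon>_def)
      thus "2 * \<epsilon> * l2norm \<xi> < e" using ep by (simp add: algebra_simps)
    qed
    obtain F c where F: "finite F" and Fc: "opbound (\<lambda>\<xi> h. x \<xi> h - psum \<sigma> F c \<xi> h) \<epsilon>"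
      using x ep unfolding reduced_cstar_def by blast
    have ev1: "eventually (\<lambda>K. psum \<sigma> F c (restr K \<xi>) h = psum \<sigma> F c \<xi> h) (finite_subsets_at_top UNIV)"
      unfolding eventually_finite_subsets_at_top
      by (rule exI[of _ "(\<lambda>g. - g + h) ` F"]) (use F in \<open>auto simp: Lambda_def restr_def intro!: sum.cong\<close>)
    have ev2: "eventually (\<lambda>K. finite K) (finite_subsets_at_top (UNIV :: 'g set))"
      unfolding eventually_finite_subsets_at_top by blast
    show "\<forall>\<^sub>F K in finite_subsets_at_top UNIV. dist (x (restr K \<xi>) h) (x \<xi> h) < e"
      using ev1 ev2
    proof eventually_elim
      case (elim K)
      have "l2norm (restr K \<xi>) \<le> l2norm \<xi>"
        using restr_l2(2)[OF elim(2), of \<xi>] L2_set_le_l2norm[OF \<xi> elim(2)] by linarith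
      hence "\<epsilon> * l2norm (restr K \<xi>) \<le> \<epsilon> * l2norm \<xi>" using ep by simp
      moreover have "cmod (x (restr K \<xi>) h - psum \<sigma> F c (restr K \<xi>) h) \<le> \<epsilon> * l2norm (restr K \<xi>)"
        using opbound_cmod[OF Fc restr_l2(1)[OF elim(2), of \<xi>], of h] .
      moreover have "cmod (x \<xi> h - psum \<sigma> F c \<xi> h) \<le> \<epsilon> * l2norm \<xi>"
        using opbound_cmod[OF Fc \<xi>, of h] .
      moreover have "dist (x (restr K \<xi>) h) (x \<xi> h)
         \<le> cmod (x (restr K \<xi>) h - psum \<sigma> F c (restr K \<xi>) h) + cmod (x \<xi> h - psum \<sigma> F c \<xi> h)"
        unfolding elim(1) dist_norm using norm_triangle_ineq4[of "x (restr K \<xi>) h - psum \<sigma> F c \<xi> h" "x \<xi> h - psum \<sigma> F c \<xi> h"]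
        by simp
      ultimately show ?case using e2 by linarith
    qed
  qed
qed

text \<open>The partial sums put y into \<open>reduced_cstar \<sigma>\<close>, so only its
  coefficients have to be found; the one at g is read off from partial sums whose index set contains
  g.\<close>

lemma has_matrix_fourier_sum:
  assumes conv: "fourier_sum_conv \<sigma> \<phi> x y"
  shows "has_matrix \<sigma> y (\<lambda>g. \<phi> g * fourier_coeff x g)"
proof -
  let ?f = "\<lambda>g. \<phi> g * fourier_coeff x g"
  have fs: "\<exists>F0. finite F0 \<and> (\<forall>F. finite F \<and> F0 \<subseteq> F \<longrightarrow> opbound (\<lambda>\<xi> h. y \<xi> h - psum \<sigma> F ?f \<xi> h) \<epsilon>)"
    if "\<epsilon> > 0" for \<epsilon>
    using conv[unfolded fourier_sum_conv_def, rule_format, OF that] .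
  have "\<exists>F c. finite F \<and> opbound (\<lambda>\<xi> h. y \<xi> h - psum \<sigma> F c \<xi> h) \<epsilon>" if pos: "\<epsilon> > 0" for \<epsilon>
  proof -
    obtain F0 where "finite F0" "\<forall>F. finite F \<and> F0 \<subseteq> F \<longrightarrow> opbound (\<lambda>\<xi> h. y \<xi> h - psum \<sigma> F ?f \<xi> h) \<epsilon>"
      using fs[OF pos] by (elim exE conjE)
    thus ?thesis by (intro exI[of _ F0] exI[of _ ?f]) simp
  qed
  hence "y \<in> reduced_cstar \<sigma>" unfolding reduced_cstar_def by simp
  hence "has_matrix \<sigma> y (fourier_coeff y)" by (rule has_matrix_reduced_cstar)
  moreover have "fourier_coeff y g = \<phi> g * fourier_coeff x g" for g
  proof -
    have "cmod (fourier_coeff y g - \<phi> g * fourier_coeff x g) \<le> 0"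
    proof (rule nonpos_if_le_small_multiple[where B = 1])
      fix \<epsilon> :: real assume "\<epsilon> > 0"
      from fs[OF this] obtain F0 where F0: "finite F0"
          "\<forall>F. finite F \<and> F0 \<subseteq> F \<longrightarrow> opbound (\<lambda>\<xi> h. y \<xi> h - psum \<sigma> F ?f \<xi> h) \<epsilon>"
        by (elim exE conjE)
      have fin: "finite (insert g F0)" using F0 by simp
      have "opbound (\<lambda>\<xi> h. y \<xi> h - psum \<sigma> (insert g F0) ?f \<xi> h) \<epsilon>"
        using F0(2)[rule_format, of "insert g F0"] fin by blast
      from fourier_coeff_approx[OF fin this, of g]
      show "cmod (fourier_coeff y g - \<phi> g * fourier_coeff x g) \<le> \<epsilon> * 1" by simp
    qed simp
    thus ?thesis by simp
  qed
  hence "fourier_coeff y = ?f" by (rule ext)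
  ultimately show ?thesis by simp
qed

lemma fourier_coeff_l2:
  assumes "x \<in> reduced_cstar \<sigma>"
  shows "fourier_coeff x \<in> l2"
proof -
  obtain F c where F: "finite F" and Fc: "opbound (\<lambda>\<xi> h. x \<xi> h - psum \<sigma> F c \<xi> h) 1"
    using assms unfolding reduced_cstar_def by (auto dest!: spec[of _ 1])
  have "opbound x (1 + (\<Sum>g\<in>F. cmod (c g)))"
    using opbound_add[OF Fc opbound_psum[OF F, of c]] by simp
  thus ?thesis unfolding fourier_coeff_def opbound_def using delta_e_l2 by blast
qed

end

section \<open>Multipliers of hyperbolic groups\<close>

lemma hilbert_schmidt_bound:
  fixes G :: "'h \<Rightarrow> 'k \<Rightarrow> real"
  assumes "finite H" "finite K"
  shows "(\<Sum>h\<in>H. \<Sum>k\<in>K. \<bar>G h k\<bar> * \<bar>x k\<bar> * \<bar>z h\<bar>)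
     \<le> L2_set (\<lambda>(h, k). G h k) (H \<times> K) * (L2_set x K * L2_set z H)"
proof -
  have "(\<Sum>h\<in>H. \<Sum>k\<in>K. \<bar>G h k\<bar> * \<bar>x k\<bar> * \<bar>z h\<bar>)
     = (\<Sum>p\<in>H \<times> K. \<bar>(\<lambda>(h, k). G h k) p\<bar> * \<bar>(\<lambda>(h, k). x k * z h) p\<bar>)"
    by (simp add: sum.cartesian_product case_prod_beta' abs_mult mult.assoc)
  also have "\<dots> \<le> L2_set (\<lambda>(h, k). G h k) (H \<times> K) * L2_set (\<lambda>(h, k). x k * z h) (H \<times> K)"
    by (rule L2_set_mult_ineq)
  also have "(\<Sum>p\<in>H \<times> K. ((\<lambda>(h, k). x k * z h) p)\<^sup>2) = (\<Sum>k\<in>K. (x k)\<^sup>2) * (\<Sum>h\<in>H. (z h)\<^sup>2)"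
    by (simp add: case_prod_beta' sum.cartesian_product' power_mult_distrib sum_product
        sum.swap[of _ K H])
  hence "L2_set (\<lambda>(h, k). x k * z h) (H \<times> K) = L2_set x K * L2_set z H"
    by (simp add: L2_set_def real_sqrt_mult)
  finally show ?thesis .
qed

locale hyperbolic_twisted = twisted_group \<sigma> + tripod_metric "\<lambda>x y. L (- x + y)" 0 R N
  for \<sigma> :: "'g::group_add \<Rightarrow> 'g \<Rightarrow> complex" and L :: "'g \<Rightarrow> nat" and R N :: nat +
  assumes finite_ball: "finite {g. L g \<le> n}"
begin

lemma L_uminus [simp]: "L (- g) = L g"
  using d_sym[of g 0] by simp

definition schur_const :: real where
  "schur_const = real ((R + 2) * 2 ^ ((R + 2) * (N + R + 2)))"

lemma schur_const_nonneg: "schur_const \<ge> 0"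
  by (simp add: schur_const_def)

text \<open>For finite H and K the kernel is needed only on the finite set X of negatives. There it
  is a limit of inner products of bounded vectors, and the Schur bound, the same for all M, passes
  to the limit.\<close>

lemma bform_multiplier:
  assumes f: "bform (coeff_matrix \<sigma> f) c" and c: "c \<ge> 0" and r: "0 < r" "r < 1"
  shows "bform (coeff_matrix \<sigma> (\<lambda>g. complex_of_real (r ^ L g) * f g)) (schur_const * c)"
  unfolding bform_def
proof (intro allI impI)
  fix H K :: "'g set" and \<xi> \<zeta> assume HK: "finite H" "finite K"
  define X where "X = uminus ` H \<union> uminus ` K"
  have "finite X" using HK by (simp add: X_def)
  from ozawa_kernel[OF r this] obtain \<Omega> :: "nat \<Rightarrow> (nat \<times> ('g + nat)) set set" and a b where
    ab: "\<And>M x. x \<in> X \<Longrightarrow> (\<Sum>\<omega>\<in>\<Omega> M. (a M x \<omega>)\<^sup>2) \<le> schur_const"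
      "\<And>M x. x \<in> X \<Longrightarrow> (\<Sum>\<omega>\<in>\<Omega> M. (b M x \<omega>)\<^sup>2) \<le> schur_const"
    and lim: "\<And>x y. x \<in> X \<Longrightarrow> y \<in> X \<Longrightarrow>
      (\<lambda>M. \<Sum>\<omega>\<in>\<Omega> M. a M x \<omega> * b M y \<omega>) \<longlonglongrightarrow> r ^ L (- x + y)"
    unfolding schur_const_def by (elim exE conjE) blast
  have lim': "(\<lambda>M. \<Sum>\<omega>\<in>\<Omega> M. a M (- h) \<omega> * b M (- k) \<omega>) \<longlonglongrightarrow> r ^ L (h - k)"
    if "h \<in> H" "k \<in> K" for h k
    using lim[of "- h" "- k"] that by (simp add: X_def)
  let ?B = "schur_const * c * L2_set (\<lambda>k. cmod (\<xi> k)) K * L2_set (\<lambda>h. cmod (\<zeta> h)) H"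
  have lim_norm: "(\<lambda>M. cmod (\<Sum>h\<in>H. \<Sum>k\<in>K. coeff_matrix \<sigma> f h k * of_real (\<Sum>\<omega>\<in>\<Omega> M. a M (- h) \<omega> * b M (- k) \<omega>) * \<xi> k * \<zeta> h))
    \<longlonglongrightarrow> cmod (\<Sum>h\<in>H. \<Sum>k\<in>K. coeff_matrix \<sigma> f h k * of_real (r ^ L (h - k)) * \<xi> k * \<zeta> h)"
    by (intro tendsto_intros lim')
  have bound: "cmod (\<Sum>h\<in>H. \<Sum>k\<in>K. coeff_matrix \<sigma> f h k * of_real (\<Sum>\<omega>\<in>\<Omega> M. a M (- h) \<omega> * b M (- k) \<omega>) * \<xi> k * \<zeta> h) \<le> ?B" for M
    using ab HK schur_const_nonneg
    by (intro schur_multiplier_bound[OF f c]) (auto simp: X_def)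
  have "cmod (\<Sum>h\<in>H. \<Sum>k\<in>K. coeff_matrix \<sigma> f h k * of_real (r ^ L (h - k)) * \<xi> k * \<zeta> h) \<le> ?B"
    by (rule tendsto_upperbound[OF lim_norm always_eventually[OF allI[OF bound]]]) simp
  thus "cmod (\<Sum>h\<in>H. \<Sum>k\<in>K. coeff_matrix \<sigma> (\<lambda>g. complex_of_real (r ^ L g) * f g) h k * \<xi> k * \<zeta> h) \<le> ?B"
    by (simp add: coeff_matrix_def mult_ac)
qed

section \<open>Haagerup's inequality\<close>

definition slab :: "'g \<Rightarrow> nat \<Rightarrow> 'g set" where
  "slab x j = {w. L (- x + w) \<le> j \<and> L w + j \<le> L x + Suc R}"

lemma finite_slab: "finite (slab x j)" and card_slab: "card (slab x j) \<le> N"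
  using bigon[of x j] by (simp_all add: slab_def)

text \<open>w is the tripod centre of -h, -k and the base point 0, and j is its distance from
  -h.\<close>

lemma slab_split:
  assumes "L (h - k) = n"
  shows "\<exists>j\<le>n. \<exists>w. w \<in> slab (- h) j \<and> w \<in> slab (- k) (n - j)"
proof -
  obtain w where w: "L (h + w) + L (- w - k) = L (h - k)" "L w + L (h + w) \<le> L h + R" "L w + L (k + w) \<le> L k + R"
    using center[of "- h" "- k"] by auto
  have "L (- w - k) = L (k + w)" using L_uminus[of "k + w"] by (simp add: minus_add)
  thus ?thesis using w assms
    by (intro exI[of _ "L (h + w)"] conjI exI[of _ w]) (auto simp: slab_def)
qed

text \<open>With w fixed, a pair (h, k) is determined by g = h - k and u = h + w. Here u lies almost
  on a geodesic from g to 0, at position n - j, so at most N pairs share the same g.\<close>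

lemma slab_fiber_sum:
  assumes B: "\<And>D. finite D \<Longrightarrow> L2_set (\<lambda>g. cmod (f g)) D \<le> B" and P: "finite P"
    and PP: "\<And>h k. (h, k) \<in> P \<Longrightarrow> L (h + w) \<le> j \<and> L (k + w) \<le> n - j \<and> L (h - k) = n" and j: "j \<le> n"
  shows "(\<Sum>(h, k)\<in>P. (cmod (f (h - k)))\<^sup>2) \<le> real N * B\<^sup>2"
proof -
  define D where "D = (\<lambda>(h, k). h - k) ` P"
  have D: "finite D" using P by (simp add: D_def)
  let ?m = "\<lambda>(h, k). (h - k, h + w)"
  have inj: "inj_on ?m P"
    by (rule inj_onI) (auto simp: diff_conv_add_uminus simp del: add_uminus_conv_diff)
  have sub: "?m ` P \<subseteq> Sigma D (\<lambda>g. slab g (n - j))"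
  proof safe
    fix h k assume hk: "(h, k) \<in> P"
    show "h - k \<in> D" using hk by (force simp: D_def)
    have "- (h - k) + (h + w) = k + w" by (simp add: add.assoc[symmetric])
    moreover have "L (h + w) + (n - j) \<le> L (h - k) + Suc R" using PP[OF hk] j by linarith
    ultimately show "h + w \<in> slab (h - k) (n - j)" using PP[OF hk] by (simp add: slab_def)
  qed
  have "(\<Sum>(h, k)\<in>P. (cmod (f (h - k)))\<^sup>2) = (\<Sum>(g, u)\<in>?m ` P. (cmod (f g))\<^sup>2)"
    by (subst sum.reindex[OF inj]) (auto intro!: sum.cong)
  also have "\<dots> \<le> (\<Sum>(g, u)\<in>Sigma D (\<lambda>g. slab g (n - j)). (cmod (f g))\<^sup>2)"
    using D finite_slab by (intro sum_mono2 sub) auto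
  also have "\<dots> = (\<Sum>g\<in>D. \<Sum>u\<in>slab g (n - j). (cmod (f g))\<^sup>2)"
    using D finite_slab by (subst sum.Sigma) auto
  also have "\<dots> \<le> (\<Sum>g\<in>D. real N * (cmod (f g))\<^sup>2)"
    using card_slab by (intro sum_mono) (auto intro!: mult_right_mono)
  also have "\<dots> = real N * (L2_set (\<lambda>g. cmod (f g)) D)\<^sup>2"
    by (simp add: sum_distrib_left L2_set_def sum_nonneg)
  also have "\<dots> \<le> real N * B\<^sup>2"
    using B[OF D] by (intro mult_left_mono power_mono) auto
  finally show ?thesis .
qed

text \<open>
  Pairs at distance n are grouped by a point w at distance j from one end and n - j from the other:
  each block is a Hilbert-Schmidt matrix, and the blocks for fixed j overlap at most N times in
  either variable.
\<close>

lemma rapid_decay: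
  assumes B: "\<And>D. finite D \<Longrightarrow> L2_set (\<lambda>g. cmod (f g)) D \<le> B"
  shows "bform (\<lambda>h k. if L (h - k) = n then coeff_matrix \<sigma> f h k else 0) (real (n + 1) * (real N * sqrt (real N) * B))"
  unfolding bform_def
proof (intro allI impI)
  fix H K :: "'g set" and \<xi> \<zeta> :: "'g \<Rightarrow> complex" assume HK: "finite H" "finite K"
  have B0: "B \<ge> 0" using B[of "{}"] by simp
  define F where "F h k = (if L (h - k) = n then cmod (f (h - k)) else 0)" for h k
  define W where "W = (\<Union>h\<in>H. \<Union>j\<in>{..n}. slab (- h) j)"
  have W: "finite W" using HK finite_slab by (auto simp: W_def)
  define \<alpha> where "\<alpha> j w h = (if w \<in> slab (- h) j then 1 else 0 :: real)" for j w h
  have \<alpha>0: "\<alpha> j w h \<ge> 0" "\<bar>\<alpha> j w h\<bar> = \<alpha> j w h" "(\<alpha> j w h)\<^sup>2 = \<alpha> j w h" "\<alpha> j w h * \<alpha> j w h = \<alpha> j w h" for j w h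
    by (auto simp: \<alpha>_def)
  have F0: "F h k \<ge> 0" for h k by (simp add: F_def)
  let ?nx = "L2_set (\<lambda>k. cmod (\<xi> k)) K" and ?nz = "L2_set (\<lambda>h. cmod (\<zeta> h)) H"
  have overlap: "L2_set (\<lambda>w. L2_set (\<lambda>k. \<alpha> j w k * cmod (\<theta> k)) K') W \<le> sqrt (real N) * L2_set (\<lambda>k. cmod (\<theta> k)) K'"
    for j K' and \<theta> :: "'g \<Rightarrow> complex"
  proof -
    have "(\<Sum>w\<in>W. (L2_set (\<lambda>k. \<alpha> j w k * cmod (\<theta> k)) K')\<^sup>2) = (\<Sum>w\<in>W. \<Sum>k\<in>K'. \<alpha> j w k * (cmod (\<theta> k))\<^sup>2)"
      by (simp add: L2_set_def sum_nonneg power_mult_distrib \<alpha>0)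
    also have "\<dots> = (\<Sum>k\<in>K'. (\<Sum>w\<in>W. \<alpha> j w k) * (cmod (\<theta> k))\<^sup>2)"
      by (subst sum.swap) (simp add: sum_distrib_right)
    also have "\<dots> \<le> (\<Sum>k\<in>K'. real N * (cmod (\<theta> k))\<^sup>2)"
    proof (intro sum_mono mult_right_mono)
      fix k
      have "(\<Sum>w\<in>W. \<alpha> j w k) = real (card {w\<in>W. w \<in> slab (- k) j})"
        using W by (simp add: \<alpha>_def sum.inter_filter[symmetric])
      also have "\<dots> \<le> real (card (slab (- k) j))"
        using finite_slab by (intro of_nat_mono card_mono) auto
      also have "\<dots> \<le> real N" using card_slab by simp
      finally show "(\<Sum>w\<in>W. \<alpha> j w k) \<le> real N" .
    qed simp
    finally have "sqrt (\<Sum>w\<in>W. (L2_set (\<lambda>k. \<alpha> j w k * cmod (\<theta> k)) K')\<^sup>2) \<le> sqrt (real N * (\<Sum>k\<in>K'. (cmod (\<theta> k))\<^sup>2))"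
      by (simp add: sum_distrib_left)
    thus ?thesis by (simp add: L2_set_def[of _ W] L2_set_def[of "\<lambda>k. cmod (\<theta> k)"] real_sqrt_mult)
  qed
  have block: "(\<Sum>h\<in>H. \<Sum>k\<in>K. \<alpha> j w h * \<alpha> (n - j) w k * F h k * cmod (\<xi> k) * cmod (\<zeta> h))
      \<le> sqrt (real N) * B * (L2_set (\<lambda>k. \<alpha> (n - j) w k * cmod (\<xi> k)) K * L2_set (\<lambda>h. \<alpha> j w h * cmod (\<zeta> h)) H)"
    if j: "j \<le> n" for j w
  proof -
    define G where "G h k = \<alpha> j w h * \<alpha> (n - j) w k * F h k" for h k
    have "(\<Sum>h\<in>H. \<Sum>k\<in>K. \<alpha> j w h * \<alpha> (n - j) w k * F h k * cmod (\<xi> k) * cmod (\<zeta> h))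
       = (\<Sum>h\<in>H. \<Sum>k\<in>K. \<bar>G h k\<bar> * \<bar>\<alpha> (n - j) w k * cmod (\<xi> k)\<bar> * \<bar>\<alpha> j w h * cmod (\<zeta> h)\<bar>)"
      by (intro sum.cong refl) (simp add: G_def \<alpha>_def F_def)
    also have "\<dots> \<le> L2_set (\<lambda>(h, k). G h k) (H \<times> K) *
        (L2_set (\<lambda>k. \<alpha> (n - j) w k * cmod (\<xi> k)) K * L2_set (\<lambda>h. \<alpha> j w h * cmod (\<zeta> h)) H)"
      by (rule hilbert_schmidt_bound[OF HK])
    also have "\<dots> \<le> sqrt (real N) * B *
        (L2_set (\<lambda>k. \<alpha> (n - j) w k * cmod (\<xi> k)) K * L2_set (\<lambda>h. \<alpha> j w h * cmod (\<zeta> h)) H)"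
    proof (rule mult_right_mono)
      define P where "P = {(h, k)\<in>H \<times> K. w \<in> slab (- h) j \<and> w \<in> slab (- k) (n - j) \<and> L (h - k) = n}"
      have fP: "finite P" by (rule finite_subset[of _ "H \<times> K"]) (use HK in \<open>auto simp: P_def\<close>)
      have "(\<Sum>p\<in>H \<times> K. ((\<lambda>(h, k). G h k) p)\<^sup>2) = (\<Sum>(h, k)\<in>P. (cmod (f (h - k)))\<^sup>2)"
        using HK by (intro sum.mono_neutral_cong_right) (auto simp: P_def G_def \<alpha>_def F_def split: if_splits)
      also have "\<dots> \<le> real N * B\<^sup>2"
        by (rule slab_fiber_sum[OF B fP _ j, where w = w]) (auto simp: P_def slab_def)
      finally have "sqrt (\<Sum>p\<in>H \<times> K. ((\<lambda>(h, k). G h k) p)\<^sup>2) \<le> sqrt (real N * B\<^sup>2)"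
        by (rule real_sqrt_le_mono)
      thus "L2_set (\<lambda>(h, k). G h k) (H \<times> K) \<le> sqrt (real N) * B"
        using B0 by (simp add: L2_set_def real_sqrt_mult)
    qed simp
    finally show ?thesis .
  qed
  \<comment> \<open>One factor sqrt N is the Hilbert-Schmidt bound of a block, two more come from
    the overlaps in the two variables; n + 1 will count the values of j.\<close>
  have level: "(\<Sum>w\<in>W. \<Sum>h\<in>H. \<Sum>k\<in>K. \<alpha> j w h * \<alpha> (n - j) w k * F h k * cmod (\<xi> k) * cmod (\<zeta> h))
      \<le> real N * sqrt (real N) * B * ?nx * ?nz" if j: "j \<le> n" for j
  proof -
    let ?x = "\<lambda>w. L2_set (\<lambda>k. \<alpha> (n - j) w k * cmod (\<xi> k)) K" and ?z = "\<lambda>w. L2_set (\<lambda>h. \<alpha> j w h * cmod (\<zeta> h)) H"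
    have "(\<Sum>w\<in>W. \<Sum>h\<in>H. \<Sum>k\<in>K. \<alpha> j w h * \<alpha> (n - j) w k * F h k * cmod (\<xi> k) * cmod (\<zeta> h))
       \<le> (\<Sum>w\<in>W. sqrt (real N) * B * (?x w * ?z w))" by (intro sum_mono block j)
    also have "\<dots> = sqrt (real N) * B * (\<Sum>w\<in>W. \<bar>?x w\<bar> * \<bar>?z w\<bar>)" by (simp add: sum_distrib_left)
    also have "\<dots> \<le> sqrt (real N) * B * (L2_set ?x W * L2_set ?z W)"
      using B0 by (intro mult_left_mono L2_set_mult_ineq) auto
    also have "\<dots> \<le> sqrt (real N) * B * ((sqrt (real N) * ?nx) * (sqrt (real N) * ?nz))"
      using B0 by (intro mult_left_mono mult_mono overlap) auto
    also have "\<dots> = (sqrt (real N) * sqrt (real N)) * sqrt (real N) * B * ?nx * ?nz"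
      by (simp only: mult_ac)
    finally show ?thesis by simp
  qed
  have "cmod (\<Sum>h\<in>H. \<Sum>k\<in>K. (if L (h - k) = n then coeff_matrix \<sigma> f h k else 0) * \<xi> k * \<zeta> h)
     \<le> (\<Sum>h\<in>H. \<Sum>k\<in>K. F h k * cmod (\<xi> k) * cmod (\<zeta> h))"
    by (intro sum_norm_le) (simp add: F_def norm_mult coeff_matrix_def)
  \<comment> \<open>After passing to absolute values it is enough that each pair at distance n is
    covered by some block; repeated coverage only increases the right-hand side.\<close>
  also have "\<dots> \<le> (\<Sum>h\<in>H. \<Sum>k\<in>K. \<Sum>j\<le>n. \<Sum>w\<in>W. \<alpha> j w h * \<alpha> (n - j) w k * F h k * cmod (\<xi> k) * cmod (\<zeta> h))"
  proof (intro sum_mono)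
    fix h k assume hk: "h \<in> H" "k \<in> K"
    let ?t = "\<lambda>j w. \<alpha> j w h * \<alpha> (n - j) w k * F h k * cmod (\<xi> k) * cmod (\<zeta> h)"
    have t0: "?t j w \<ge> 0" for j w using \<alpha>0 F0 by simp
    show "F h k * cmod (\<xi> k) * cmod (\<zeta> h) \<le> (\<Sum>j\<le>n. \<Sum>w\<in>W. ?t j w)"
    proof (cases "L (h - k) = n")
      case False
      then show ?thesis by (simp add: F_def)
    next
      case True
      from slab_split[OF this] obtain j w where jw: "j \<le> n" "w \<in> slab (- h) j" "w \<in> slab (- k) (n - j)" by blast
      have wW: "w \<in> W" using jw hk by (auto simp: W_def)
      have "F h k * cmod (\<xi> k) * cmod (\<zeta> h) = ?t j w" using jw by (simp add: \<alpha>_def)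
      also have "\<dots> \<le> (\<Sum>w\<in>W. ?t j w)" by (rule member_le_sum[OF wW t0 W])
      also have "\<dots> \<le> (\<Sum>j\<le>n. \<Sum>w\<in>W. ?t j w)"
        using jw t0 by (intro member_le_sum[where f = "\<lambda>j. \<Sum>w\<in>W. ?t j w"] sum_nonneg) auto
      finally show ?thesis .
    qed
  qed
  also have "\<dots> = (\<Sum>j\<le>n. \<Sum>w\<in>W. \<Sum>h\<in>H. \<Sum>k\<in>K. \<alpha> j w h * \<alpha> (n - j) w k * F h k * cmod (\<xi> k) * cmod (\<zeta> h))"
    by (simp only: sum.swap[of _ "{..n}" K] sum.swap[of _ "{..n}" H] sum.swap[of _ W K] sum.swap[of _ W H])
  also have "\<dots> \<le> (\<Sum>j\<le>n. real N * sqrt (real N) * B * ?nx * ?nz)"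
    by (intro sum_mono level) auto
  also have "\<dots> = real (n + 1) * (real N * sqrt (real N) * B) * ?nx * ?nz"
    by (simp add: algebra_simps)
  finally show "cmod (\<Sum>h\<in>H. \<Sum>k\<in>K. (if L (h - k) = n then coeff_matrix \<sigma> f h k else 0) * \<xi> k * \<zeta> h)
     \<le> real (n + 1) * (real N * sqrt (real N) * B) * ?nx * ?nz" .
qed

section \<open>Norm convergence of the series and the limit r -> 1\<close>

text \<open>Splitting F by length and applying \<open>rapid_decay\<close> on each sphere bounds the
  norm by a constant times the sum of (n + 1) * r^n over the lengths that occur, which is dominated
  by a tail of a convergent series, uniformly in F.\<close>

lemma opbound_outside_ball:
  assumes f: "f \<in> l2" and r: "0 < r" "r < 1" and e: "\<epsilon> > 0"
  shows "\<exists>M. \<forall>F. finite F \<and> (\<forall>g\<in>F. M < L g) \<longrightarrow> opbound (psum \<sigma> F (\<lambda>g. complex_of_real (r ^ L g) * f g)) \<epsilon>"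
proof -
  define C where "C = real N * sqrt (real N) * l2norm f"
  have C0: "C \<ge> 0" by (simp add: C_def l2norm_nonneg)
  define s where "s n = C * (real (n + 1) * r ^ n)" for n
  have s0: "s n \<ge> 0" for n using C0 r by (simp add: s_def)
  have "summable (\<lambda>n. real (n + 1) * r ^ n)"
    using r geometric_deriv_sums[of r] by (auto simp: sums_iff add.commute)
  hence s: "summable s" unfolding s_def by (rule summable_mult)
  obtain M where M: "norm (\<Sum>i. s (i + M)) < \<epsilon>" using suminf_exist_split[OF e s] by blast
  have tail: "(\<Sum>n\<in>I. s n) \<le> \<epsilon>" if I: "finite I" "\<And>n. n \<in> I \<Longrightarrow> M \<le> n" for I
  proof -
    have "(\<Sum>n\<in>I. s n) = (\<Sum>i\<in>(\<lambda>n. n - M) ` I. s (i + M))"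
    proof (subst sum.reindex)
      show "inj_on (\<lambda>n. n - M) I"
        by (rule inj_onI) (use I(2) eq_diff_iff in blast)
    qed (use I in \<open>auto intro!: sum.cong\<close>)
    also have "\<dots> \<le> (\<Sum>i. s (i + M))"
      using I s s0 by (intro sum_le_suminf summable_ignore_initial_segment) auto
    finally show ?thesis using M by simp
  qed
  have "opbound (psum \<sigma> F (\<lambda>g. complex_of_real (r ^ L g) * f g)) \<epsilon>"
    if F: "finite F" "\<And>g. g \<in> F \<Longrightarrow> M < L g" for F
  proof -
    \<comment> \<open>The weight r^n is independent of g, so the bound r^n * l2norm f holds over the
      whole group; the condition \<open>L (h - k) = n\<close> in \<open>rapid_decay\<close> selects
      the sphere on which it equals r^(L g).\<close>
    define f' where "f' n g = (if g \<in> F then complex_of_real (r ^ n) * f g else 0)" for n g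
    have nf: "L2_set (\<lambda>g. cmod (f' n g)) D \<le> r ^ n * l2norm f" if D: "finite D" for n D
    proof -
      have "L2_set (\<lambda>g. cmod (f' n g)) D \<le> L2_set (\<lambda>g. r ^ n * cmod (f g)) D"
        using r by (intro L2_set_mono) (auto simp: f'_def norm_mult norm_power)
      also have "\<dots> = r ^ n * L2_set (\<lambda>g. cmod (f g)) D"
        using r by (simp add: L2_set_right_distrib)
      also have "\<dots> \<le> r ^ n * l2norm f"
        using r L2_set_le_l2norm[OF f D] by (intro mult_left_mono) auto
      finally show ?thesis .
    qed
    have "bform (\<lambda>h k. \<Sum>n\<in>L ` F. if L (h - k) = n then coeff_matrix \<sigma> (f' n) h k else 0)
        (\<Sum>n\<in>L ` F. real (n + 1) * (real N * sqrt (real N) * (r ^ n * l2norm f)))"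
      using F by (intro bform_sum rapid_decay nf) auto
    also have "(\<lambda>h k. \<Sum>n\<in>L ` F. if L (h - k) = n then coeff_matrix \<sigma> (f' n) h k else 0)
       = coeff_matrix \<sigma> (\<lambda>g. if g \<in> F then complex_of_real (r ^ L g) * f g else 0)"
    proof (intro ext)
      fix h k
      have "(\<Sum>n\<in>L ` F. if L (h - k) = n then coeff_matrix \<sigma> (f' n) h k else 0)
         = (if L (h - k) \<in> L ` F then coeff_matrix \<sigma> (f' (L (h - k))) h k else 0)" using F by simp
      also have "\<dots> = coeff_matrix \<sigma> (\<lambda>g. if g \<in> F then complex_of_real (r ^ L g) * f g else 0) h k"
        by (auto simp: coeff_matrix_def f'_def)
      finally show "(\<Sum>n\<in>L ` F. if L (h - k) = n then coeff_matrix \<sigma> (f' n) h k else 0)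
         = coeff_matrix \<sigma> (\<lambda>g. if g \<in> F then complex_of_real (r ^ L g) * f g else 0) h k" .
    qed
    also have "(\<Sum>n\<in>L ` F. real (n + 1) * (real N * sqrt (real N) * (r ^ n * l2norm f))) = (\<Sum>n\<in>L ` F. s n)"
      by (simp add: s_def C_def mult_ac)
    finally have "bform (coeff_matrix \<sigma> (\<lambda>g. if g \<in> F then complex_of_real (r ^ L g) * f g else 0)) \<epsilon>"
      by (rule bform_mono[OF _ tail]) (use F in \<open>auto simp: less_imp_le\<close>)
    from opbound_if_bform[OF has_matrix_psum[OF F(1)] this] show ?thesis using e by simp
  qed
  thus ?thesis by (intro exI[of _ M]) simp
qed

lemma exists_fourier_sum:
  assumes x: "x \<in> reduced_cstar \<sigma>" and r: "0 < r" "r < 1"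
  shows "\<exists>y. fourier_sum_conv \<sigma> (\<lambda>g. complex_of_real (r ^ L g)) x y"
proof -
  let ?f = "\<lambda>g. complex_of_real (r ^ L g) * fourier_coeff x g"
  let ?b = "\<lambda>M. {g. L g \<le> M}"
  let ?S = "\<lambda>M. psum \<sigma> (?b M) ?f"
  have cauchy: "\<exists>M0. \<forall>F M. finite F \<and> ?b M0 \<subseteq> F \<and> M0 \<le> M \<longrightarrow> opbound (\<lambda>\<xi> h. ?S M \<xi> h - psum \<sigma> F ?f \<xi> h) \<epsilon>"
    if e: "\<epsilon> > 0" for \<epsilon>
  proof -
    from opbound_outside_ball[OF fourier_coeff_l2[OF x] r half_gt_zero[OF e]]
    obtain M0 where M0: "\<forall>F. finite F \<and> (\<forall>g\<in>F. M0 < L g) \<longrightarrow> opbound (psum \<sigma> F ?f) (\<epsilon> / 2)" ..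
    have "opbound (\<lambda>\<xi> h. ?S M \<xi> h - psum \<sigma> F ?f \<xi> h) \<epsilon>"
      if F: "finite F" "?b M0 \<subseteq> F" and M: "M0 \<le> M" for F M
    proof -
      \<comment> \<open>Both index sets contain the ball of radius M0, so their two differences
        consist of elements longer than M0.\<close>
      have 1: "opbound (psum \<sigma> (?b M - F) ?f) (\<epsilon> / 2)"
        using finite_ball F by (intro M0[rule_format]) (auto simp: not_le[symmetric])
      have 2: "opbound (psum \<sigma> (F - ?b M) ?f) (\<epsilon> / 2)"
        using F M by (intro M0[rule_format]) auto
      have "psum \<sigma> (?b M - F) ?f \<xi> h - psum \<sigma> (F - ?b M) ?f \<xi> h = ?S M \<xi> h - psum \<sigma> F ?f \<xi> h" for \<xi> h
        using sum.Int_Diff[OF finite_ball[of M], of "\<lambda>g. ?f g * Lambda \<sigma> g \<xi> h" F]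
          sum.Int_Diff[OF F(1), of "\<lambda>g. ?f g * Lambda \<sigma> g \<xi> h" "?b M"]
        by (simp add: Int_commute)
      thus ?thesis using opbound_diff[OF 1 2] by simp
    qed
    thus ?thesis by (intro exI[of _ M0] allI impI) simp
  qed
  \<comment> \<open>Outside \<open>l2\<close> the limit may fail to exist; \<open>opbound\<close>
    never tests y there.\<close>
  define y where "y \<xi> h = lim (\<lambda>M. ?S M \<xi> h)" for \<xi> h
  have conv: "(\<lambda>M. ?S M \<xi> h) \<longlonglongrightarrow> y \<xi> h" if \<xi>: "\<xi> \<in> l2" for \<xi> h
  proof -
    have "Cauchy (\<lambda>M. ?S M \<xi> h)"
    proof (rule metric_CauchyI)
      fix e :: real assume e: "e > 0"
      define \<epsilon> where "\<epsilon> = e / (2 * l2norm \<xi> + 1)"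
      have ep: "\<epsilon> > 0" using e l2norm_nonneg[of \<xi>] by (simp add: \<epsilon>_def)
      have "\<epsilon> * (2 * l2norm \<xi> + 1) = e" using l2norm_nonneg[of \<xi>] by (simp add: \<epsilon>_def)
      hence e2: "\<epsilon> * l2norm \<xi> < e" using ep mult_nonneg_nonneg[OF less_imp_le[OF ep] l2norm_nonneg[of \<xi>]]
        by (simp add: algebra_simps)
      from cauchy[OF ep] obtain M0 where M0: "\<forall>F M. finite F \<and> ?b M0 \<subseteq> F \<and> M0 \<le> M \<longrightarrow>
          opbound (\<lambda>\<xi> h. ?S M \<xi> h - psum \<sigma> F ?f \<xi> h) \<epsilon>" ..
      have "dist (?S m \<xi> h) (?S n \<xi> h) < e" if "m \<ge> M0" "n \<ge> M0" for m n
      proof -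
        have "opbound (\<lambda>\<xi> h. ?S m \<xi> h - ?S n \<xi> h) \<epsilon>"
          using that finite_ball by (intro M0[rule_format]) auto
        from opbound_cmod[OF this \<xi>, of h] e2 show ?thesis by (simp add: dist_norm)
      qed
      thus "\<exists>M. \<forall>m\<ge>M. \<forall>n\<ge>M. dist (?S m \<xi> h) (?S n \<xi> h) < e" by blast
    qed
    thus ?thesis unfolding y_def by (simp add: Cauchy_convergent_iff convergent_LIMSEQ_iff)
  qed
  have "fourier_sum_conv \<sigma> (\<lambda>g. complex_of_real (r ^ L g)) x y"
    unfolding fourier_sum_conv_def
  proof (intro allI impI)
    fix \<epsilon> :: real assume "\<epsilon> > 0"
    from cauchy[OF this] obtain M0 where M0: "\<forall>F M. finite F \<and> ?b M0 \<subseteq> F \<and> M0 \<le> M \<longrightarrow>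
        opbound (\<lambda>\<xi> h. ?S M \<xi> h - psum \<sigma> F ?f \<xi> h) \<epsilon>" ..
    have "opbound (\<lambda>\<xi> h. y \<xi> h - psum \<sigma> F ?f \<xi> h) \<epsilon>" if F: "finite F" "?b M0 \<subseteq> F" for F
    proof (rule opbound_limit[where F = sequentially])
      show "(\<lambda>M. ?S M \<xi> h - psum \<sigma> F ?f \<xi> h) \<longlonglongrightarrow> y \<xi> h - psum \<sigma> F ?f \<xi> h" if "\<xi> \<in> l2" for \<xi> h
        using conv[OF that] by (intro tendsto_intros)
      show "\<forall>\<^sub>F M in sequentially. opbound (\<lambda>\<xi> h. ?S M \<xi> h - psum \<sigma> F ?f \<xi> h) \<epsilon>"
        unfolding eventually_sequentially using M0 F by (intro exI[of _ M0]) simp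
    qed simp
    thus "\<exists>F0. finite F0 \<and> (\<forall>F. finite F \<and> F0 \<subseteq> F \<longrightarrow> opbound (\<lambda>\<xi> h. y \<xi> h - psum \<sigma> F ?f \<xi> h) \<epsilon>)"
      using finite_ball[of M0] by (intro exI[of _ "?b M0"]) simp
  qed
  thus ?thesis by blast
qed

text \<open>The multiplier is applied to the error of a finite approximation, which serves twice: F
  = {} gives the uniform bound on the multipliers, and a close approximation reduces the limit r ->
  1 to finite sums.\<close>

lemma opbound_fourier_sum:
  assumes x: "x \<in> reduced_cstar \<sigma>" and r: "0 < r" "r < 1"
    and y: "fourier_sum_conv \<sigma> (\<lambda>g. complex_of_real (r ^ L g)) x y"
    and F: "finite F" and c: "opbound (\<lambda>\<xi> h. x \<xi> h - psum \<sigma> F a \<xi> h) c"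
  shows "opbound (\<lambda>\<xi> h. y \<xi> h - psum \<sigma> F (\<lambda>g. complex_of_real (r ^ L g) * a g) \<xi> h) (schur_const * c)"
proof -
  let ?a = "\<lambda>g. if g \<in> F then a g else 0"
  have c0: "c \<ge> 0" using opbound_nonneg[OF c] .
  have "bform (coeff_matrix \<sigma> (\<lambda>g. fourier_coeff x g - ?a g)) c"
    by (rule bform_if_opbound[OF has_matrix_diff[OF has_matrix_reduced_cstar[OF x] has_matrix_psum[OF F]] c])
  from bform_multiplier[OF this c0 r]
  have "bform (coeff_matrix \<sigma> (\<lambda>g. complex_of_real (r ^ L g) * (fourier_coeff x g - ?a g))) (schur_const * c)" .
  also have "(\<lambda>g. complex_of_real (r ^ L g) * (fourier_coeff x g - ?a g))
    = (\<lambda>g. complex_of_real (r ^ L g) * fourier_coeff x g - (if g \<in> F then complex_of_real (r ^ L g) * a g else 0))"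
    by (auto simp: right_diff_distrib)
  finally have b: "bform (coeff_matrix \<sigma> \<dots>) (schur_const * c)" .
  show ?thesis
    by (rule opbound_if_bform[OF has_matrix_diff[OF has_matrix_fourier_sum[OF y] has_matrix_psum[OF F]] b])
       (use c0 schur_const_nonneg in simp)
qed

text \<open>y and x are compared through the finite sums with coefficients
  \<open>r ^ L g * a g\<close> and \<open>a g\<close>. The errors of these two approximations are
  small uniformly in r, and the difference of the finite sums tends to 0.\<close>

lemma fourier_sum_tendsto:
  assumes x: "x \<in> reduced_cstar \<sigma>" and e: "\<epsilon> > 0"
  shows "eventually (\<lambda>r. r \<in> {0<..<1} \<and>
     (\<forall>y. fourier_sum_conv \<sigma> (\<lambda>g. complex_of_real (r ^ L g)) x y \<longrightarrow> opbound (\<lambda>\<xi> h. y \<xi> h - x \<xi> h) \<epsilon>)) (at_left 1)"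
proof -
  define \<epsilon>' where "\<epsilon>' = (\<epsilon> / 2) / (schur_const + 1)"
  have pos: "schur_const + 1 > 0" using schur_const_nonneg by simp
  have "\<epsilon>' * (schur_const + 1) = \<epsilon> / 2"
    by (rule iffD1[OF nonzero_eq_divide_eq]) (use pos in \<open>simp_all add: \<epsilon>'_def\<close>)
  moreover have "\<epsilon>' > 0" using e pos by (simp add: \<epsilon>'_def)
  ultimately have ep: "\<epsilon>' > 0" "schur_const * \<epsilon>' + \<epsilon>' = \<epsilon> / 2"
    by (simp_all add: distrib_left mult.commute)
  obtain F a where F: "finite F" and Fa: "opbound (\<lambda>\<xi> h. x \<xi> h - psum \<sigma> F a \<xi> h) \<epsilon>'"
    using x ep unfolding reduced_cstar_def by blast
  let ?a = "\<lambda>r g. complex_of_real (r ^ L g) * a g"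
  have "((\<lambda>r. \<Sum>g\<in>F. cmod (?a r g - a g)) \<longlongrightarrow> (\<Sum>g\<in>F. cmod (?a 1 g - a g))) (at_left 1)"
    by (intro tendsto_intros)
  from order_tendstoD(2)[OF this, of "\<epsilon> / 2"]
  have "eventually (\<lambda>r. (\<Sum>g\<in>F. cmod (?a r g - a g)) < \<epsilon> / 2) (at_left 1)"
    using e by simp
  moreover have "eventually (\<lambda>r. r \<in> {0<..<1}) (at_left (1::real))"
    by (rule eventually_at_left_real) simp
  ultimately show ?thesis
  proof eventually_elim
    case (elim r)
    have "opbound (\<lambda>\<xi> h. y \<xi> h - x \<xi> h) \<epsilon>" if y: "fourier_sum_conv \<sigma> (\<lambda>g. complex_of_real (r ^ L g)) x y" for y
    proof -
      have 1: "opbound (\<lambda>\<xi> h. y \<xi> h - psum \<sigma> F (?a r) \<xi> h) (schur_const * \<epsilon>')"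
        using opbound_fourier_sum[OF x _ _ y F Fa] elim by simp
      have 2: "opbound (psum \<sigma> F (\<lambda>g. ?a r g - a g)) (\<epsilon> / 2)"
        using elim by (intro opbound_mono[OF opbound_psum[OF F]]) simp
      have "opbound (\<lambda>\<xi> h. (y \<xi> h - psum \<sigma> F (?a r) \<xi> h) - (x \<xi> h - psum \<sigma> F a \<xi> h)
          + psum \<sigma> F (\<lambda>g. ?a r g - a g) \<xi> h) (schur_const * \<epsilon>' + \<epsilon>' + \<epsilon> / 2)"
        by (rule opbound_add[OF opbound_diff[OF 1 Fa] 2])
      thus ?thesis unfolding ep(2) by (simp add: left_diff_distrib sum_subtractf)
    qed
    thus ?case using elim by blast
  qed
qed

lemma bounded_fourier_summing_net_powers:
  "bounded_fourier_summing_net \<sigma> (at_left (1::real)) {0<..<1} (\<lambda>r g. complex_of_real (r ^ L g))"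
  unfolding bounded_fourier_summing_net_def
proof (intro conjI ballI allI impI)
  show "(\<lambda>g. complex_of_real (r ^ L g)) \<in> MCF \<sigma>" if "r \<in> {0<..<1}" for r
    using exists_fourier_sum that unfolding MCF_def by auto
  show "\<forall>\<^sub>F r in at_left 1. r \<in> {0<..<1} \<and>
     (\<forall>y. fourier_sum_conv \<sigma> (\<lambda>g. complex_of_real (r ^ L g)) x y \<longrightarrow> opbound (\<lambda>\<xi> h. y \<xi> h - x \<xi> h) \<epsilon>)"
    if "x \<in> reduced_cstar \<sigma>" "\<epsilon> > 0" for x \<epsilon>
    using that by (rule fourier_sum_tendsto)
  have "opbound y (schur_const * c)"
    if "r \<in> {0<..<1}" "x \<in> reduced_cstar \<sigma>" "fourier_sum_conv \<sigma> (\<lambda>g. complex_of_real (r ^ L g)) x y" "opbound x c" for r x y c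
    using opbound_fourier_sum[OF that(2) _ _ that(3), of "{}" "\<lambda>_. 0" c] that(1,4) by simp
  thus "\<exists>C. \<forall>r\<in>{0<..<1}. \<forall>x\<in>reduced_cstar \<sigma>. \<forall>y c. fourier_sum_conv \<sigma> (\<lambda>g. complex_of_real (r ^ L g)) x y
     \<longrightarrow> opbound x c \<longrightarrow> opbound y (C * c)"
    by (intro exI[of _ schur_const] ballI allI impI)
qed

end

theorem theorem5p12:
  fixes \<sigma> :: "'g::group_add \<Rightarrow> 'g \<Rightarrow> complex" and T :: "'g set"
  assumes "gromov_hyperbolic_group TYPE('g)"
    and "finite T" and "generating_set T"
    and "normalized_2cocycle \<sigma>"
  shows "bounded_fourier_summing_net \<sigma> (at_left (1::real)) {0<..<1}
           (\<lambda>r g. complex_of_real (r ^ word_length T g))"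
proof -
  obtain S :: "'g set" and \<delta> l where
    "hyperbolic_pair (\<lambda>x y. word_length S (- x + y)) (\<lambda>x y. word_length T (- x + y)) \<delta> l"
    using hyperbolic_group_pair[OF assms(1-3)] by blast
  then interpret hp: hyperbolic_pair "\<lambda>x y. word_length S (- x + y)" "\<lambda>x y. word_length T (- x + y)" \<delta> l .
  obtain R where R: "\<forall>x y z. \<exists>w. word_length T (- x + w) + word_length T (- w + y) = word_length T (- x + y)
     \<and> word_length T (- w + z) + word_length T (- x + w) \<le> word_length T (- x + z) + R
     \<and> word_length T (- w + z) + word_length T (- y + w) \<le> word_length T (- y + z) + R"
    using hp.tripod_center by blast
  obtain N where N: "\<forall>x z j. finite {w. word_length T (- x + w) \<le> j \<and> word_length T (- w + z) + j \<le> word_length T (- x + z) + Suc R}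
     \<and> card {w. word_length T (- x + w) \<le> j \<and> word_length T (- w + z) + j \<le> word_length T (- x + z) + Suc R} \<le> N"
    using hp.thin_bigon[of "Suc R"] by blast
  interpret ht: hyperbolic_twisted \<sigma> "word_length T" R N
  proof (unfold_locales, goal_cases)
    case (1 g h) show ?case using assms(4) by (simp add: normalized_2cocycle_def)
  next
    case (2 g) show ?case using assms(4) by (simp add: normalized_2cocycle_def)
  next
    case (3 x y) show ?case using R[rule_format, of x y 0] .
  next
    case (4 x j) show ?case using N[rule_format, of x j 0] by blast
  next
    case (5 x j) show ?case using N[rule_format, of x j 0] by blast
  next
    case (6 n) show ?case using assms(2,3) by (intro finite_word_ball)
  qed
  show ?thesis by (rule ht.bounded_fourier_summing_net_powers)
qed

end
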